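(* Let $\phi_*$ be a Puiseux skew product with scale factor $1/n$, and multiplicity $m = \mathfrak m(\phi)$. If $\zeta \in \mathbb{P}^1_{an}$, then $\mathfrak m(\phi_*(\zeta))$ divides $n \cdot \mathrm{lcm}(\mathfrak m(\zeta), \mathfrak m(\phi))$. Hence $\phi_*(\mathcal T_N) \subseteq \mathcal T_{nM}$ where $M = \mathrm{lcm}(\mathfrak m(\phi), N)$ (for any $N\in\mathbb N_+$).
   Context: $k$ is an algebraically closed field of characteristic $0$; $\mathbb{K}=\bigcup_{n\ge 1}k((x^{1/n}))$ is the field of Puiseux series with its $x$-adic absolute value ($0<|x|<1$ fixed), $\hat{\mathbb K}$ its completion, and $\mathbb{P}^1_{an}=\mathbb{P}^1_{an}(\hat{\mathbb K})$ the Berkovich projective line with coordinate $y$; write $\|\cdot\|_\zeta$ for the seminorm $\zeta$. $G=\mathrm{Gal}(\mathbb K/k((x)))$ acts by isometries on $\hat{\mathbb K}$ (the element attached to a compatible system $\omega=(\omega_n)$ of roots of unity sends $x^{m/n}\mapsto\omega_n^m x^{m/n}$), hence on $\hat{\mathbb K}(y)$ fixing $y$, and on $\mathbb{P}^1_{an}$. The multiplicity $\mathfrak m(\zeta)\in\mathbb N_+\cup\{\infty\}$ is the cardinality of the $G$-orbit of $\zeta$; every positive integer (and $\infty$) divides $\infty$, and an lcm involving $\infty$ is $\infty$. $\mathcal T_m=\{\zeta\in\mathbb P^1_{an}:\mathfrak m(\zeta)\mid m\}$. A Puiseux skew endomorphism is a $k$-algebra endomorphism $\phi^*$ of $\mathbb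 K(y)$ with $\phi^*(x)=\phi_1(x)=\lambda x^n+O(x^{n+1})\in k[[x]]$ ($n\in\mathbb N_+$, $\lambda\in k^\times$) and $\phi^*(y)=\phi_2\in\mathbb K(y)$. It acts on $\hat{\mathbb K}(y)$ as follows: writing $\phi_1(x)=\lambda x^n(1+h(x))$ and fixing a compatible sequence of roots $(\lambda_b)_{b\ge1}$ ($\lambda_1=\lambda$, $\lambda_{bc}^c=\lambda_b$), it sends $x^{a/b}\mapsto\lambda_b^a x^{na/b}(1+h(x))^{a/b}$ (binomial series), extended continuously. The induced Puiseux skew product $\phi_*:\mathbb P^1_{an}\to\mathbb P^1_{an}$ is defined by $\|f\|_{\phi_*(\zeta)}=\|\phi^*(f)\|_\zeta^{1/n}$; its scale factor is $1/n$. Its multiplicity $\mathfrak m(\phi)=\mathfrak m(\phi_* )$ is the cardinality of the $G$-orbit of $\phi_2\in\hat{\mathbb K}(y)$; equivalently the least $m$ with $\phi_2\in k((x^{1/m}))(y)$ (finite for Puiseux skew products). *)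

theory Defs
  imports
    "HOL-Analysis.Analysis"
    "HOL-Computational_Algebra.Computational_Algebra"
begin

section \<open>The completed field of Puiseux series\<close>

text \<open>
  The completion of the field of Puiseux series over \<open>k\<close> is realised as the field of series
  \<open>\<Sum>q. a\<^sub>q x\<^sup>q\<close> with rational exponents that have only finitely many nonzero coefficients
  below every bound. The lemmas \<open>puiseux_dense\<close> and \<open>puiseux_hat_complete\<close>
  below confirm that it is the completion of the subfield \<open>puiseux\<close>
  for the \<open>x\<close>-adic absolute value.
\<close>

typedef (overloaded) 'k puiseux_hat =
  "{f :: rat \<Rightarrow> 'k::zero. \<forall>B. finite {q. q \<le> B \<and> f q \<noteq> 0}}"
  morphisms hcoeff Abs_puiseux_hat
  by (rule exI[of _ "\<lambda>_. 0"]) simp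

setup_lifting type_definition_puiseux_hat

lemma finite_below: "finite {q. q \<le> B \<and> hcoeff f q \<noteq> 0}"
  using hcoeff[of f] by simp

lemma hat_eqI: "(\<And>q. hcoeff f q = hcoeff g q) \<Longrightarrow> f = g"
  using hcoeff_inject by (metis ext)

lemma hat_eq_iff: "f = g \<longleftrightarrow> (\<forall>q. hcoeff f q = hcoeff g q)"
  using hat_eqI by metis

lemma ex_lower_bound: "\<exists>l. \<forall>q. hcoeff f q \<noteq> 0 \<longrightarrow> l \<le> q"
proof -
  let ?S = "{q. q \<le> 0 \<and> hcoeff f q \<noteq> 0}"
  have fin: "finite (insert 0 ?S)" using finite_below by simp
  have "Min (insert 0 ?S) \<le> q" if "hcoeff f q \<noteq> 0" for q
  proof (cases "q \<le> 0")
    case True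
    then show ?thesis using fin that by (intro Min_le) auto
  next
    case False
    have "Min (insert 0 ?S) \<le> 0" using fin by (intro Min_le) auto
    then show ?thesis using False by linarith
  qed
  then show ?thesis by blast
qed

instantiation puiseux_hat :: (zero) zero
begin
lift_definition zero_puiseux_hat :: "'a puiseux_hat" is "\<lambda>_. 0" by simp
instance ..
end

lemma hcoeff_zero [simp]: "hcoeff 0 q = 0" by transfer simp

text \<open>The monomial \<open>c x\<^sup>q\<close>.\<close>

lift_definition hsingle :: "rat \<Rightarrow> 'k::zero \<Rightarrow> 'k puiseux_hat"
  is "\<lambda>q c p. if p = q then c else 0"
proof -
  fix q :: rat and c :: 'k
  fix B
  show "finite {p. p \<le> B \<and> (if p = q then c else 0) \<noteq> 0}"
    by (rule finite_subset[of _ "{q}"]) (auto split: if_splits)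
qed

instantiation puiseux_hat :: (zero_neq_one) one
begin
definition one_puiseux_hat :: "'a puiseux_hat" where "1 = hsingle 0 1"
instance ..
end

instantiation puiseux_hat :: (ab_group_add) ab_group_add
begin

lift_definition plus_puiseux_hat :: "'a puiseux_hat \<Rightarrow> 'a puiseux_hat \<Rightarrow> 'a puiseux_hat"
  is "\<lambda>f g q. f q + g q"
proof -
  fix f g :: "rat \<Rightarrow> 'a" and B
  assume "\<And>B. finite {q. q \<le> B \<and> f q \<noteq> 0}" "\<And>B. finite {q. q \<le> B \<and> g q \<noteq> 0}"
  then have "finite ({q. q \<le> B \<and> f q \<noteq> 0} \<union> {q. q \<le> B \<and> g q \<noteq> 0})" by simp
  then show "finite {q. q \<le> B \<and> f q + g q \<noteq> 0}"
    by (rule rev_finite_subset) auto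
qed

lift_definition uminus_puiseux_hat :: "'a puiseux_hat \<Rightarrow> 'a puiseux_hat"
  is "\<lambda>f q. - f q" by simp

definition minus_puiseux_hat_def: "f - g = f + - (g :: 'a puiseux_hat)"

lemma hcoeff_add [simp]: "hcoeff (f + g) q = hcoeff f q + hcoeff g q" by transfer simp
lemma hcoeff_uminus [simp]: "hcoeff (- f) q = - hcoeff f q" by transfer simp
lemma hcoeff_diff [simp]: "hcoeff (f - g) q = hcoeff f q - hcoeff g q"
  by (simp add: minus_puiseux_hat_def)

instance
  by standard (simp_all add: hat_eq_iff algebra_simps)

end

lemma hcoeff_single: "hcoeff (hsingle q c) p = (if p = q then c else 0)" by transfer simp
lemma hcoeff_one: "hcoeff 1 p = (if p = 0 then 1 else 0)"
  by (simp add: one_puiseux_hat_def hcoeff_single)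
lemma hcoeff_sum: "hcoeff (sum F A) q = (\<Sum>a\<in>A. hcoeff (F a) q)"
  by (induction A rule: infinite_finite_induct) auto

subsection \<open>Multiplication\<close>

lemma finite_conv_support:
  "finite {p. hcoeff f p \<noteq> 0 \<and> hcoeff g (q - p) \<noteq> (0::'k::zero)}"
proof -
  obtain l where l: "\<forall>q. hcoeff g q \<noteq> 0 \<longrightarrow> l \<le> q" using ex_lower_bound by blast
  show ?thesis
    by (rule finite_subset[OF _ finite_below[of "q - l" f]]) (use l in force)
qed

lemma conv_support_bound:
  assumes "\<And>p. hcoeff f p \<noteq> 0 \<Longrightarrow> l \<le> p" "\<And>p. hcoeff g p \<noteq> 0 \<Longrightarrow> l' \<le> p"
  shows "finite {a + b | a b. a + b \<le> B \<and> hcoeff f a \<noteq> 0 \<and> hcoeff g b \<noteq> (0::'k::zero)}"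
proof -
  have "{a + b | a b. a + b \<le> B \<and> hcoeff f a \<noteq> 0 \<and> hcoeff g b \<noteq> 0}
    \<subseteq> (\<lambda>(a, b). a + b) ` ({a. a \<le> B - l' \<and> hcoeff f a \<noteq> 0} \<times> {b. b \<le> B - l \<and> hcoeff g b \<noteq> 0})"
  proof clarify
    fix a b assume ab: "a + b \<le> B" "hcoeff f a \<noteq> 0" "hcoeff g b \<noteq> 0"
    then have "a \<le> B - l'" "b \<le> B - l" using assms(1)[of a] assms(2)[of b] by linarith+
    then show "a + b \<in> (\<lambda>(a, b). a + b) `
      ({a. a \<le> B - l' \<and> hcoeff f a \<noteq> 0} \<times> {b. b \<le> B - l \<and> hcoeff g b \<noteq> 0})"
      using ab by (intro image_eqI[of _ _ "(a, b)"]) auto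
  qed
  then show ?thesis
    by (rule finite_subset) (intro finite_imageI finite_cartesian_product finite_below)
qed

instantiation puiseux_hat :: (comm_ring_1) comm_ring_1
begin

definition times_puiseux_hat_def: "f * (g :: 'a puiseux_hat) = Abs_puiseux_hat
    (\<lambda>q. \<Sum>p | hcoeff f p \<noteq> 0 \<and> hcoeff g (q - p) \<noteq> 0. hcoeff f p * hcoeff g (q - p))"

lemma hcoeff_mult:
  "hcoeff (f * g) q =
     (\<Sum>p | hcoeff f p \<noteq> 0 \<and> hcoeff g (q - p) \<noteq> 0. hcoeff f p * hcoeff g (q - p))"
  for f g :: "'a puiseux_hat"
proof -
  let ?h = "\<lambda>q. \<Sum>p | hcoeff f p \<noteq> 0 \<and> hcoeff g (q - p) \<noteq> 0. hcoeff f p * hcoeff g (q - p)"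
  obtain l where l: "\<forall>q. hcoeff f q \<noteq> 0 \<longrightarrow> l \<le> q" using ex_lower_bound by blast
  obtain l' where l': "\<forall>q. hcoeff g q \<noteq> 0 \<longrightarrow> l' \<le> q" using ex_lower_bound by blast
  have "finite {q. q \<le> B \<and> ?h q \<noteq> 0}" for B
  proof (rule finite_subset)
    show "finite {a + b | a b. a + b \<le> B \<and> hcoeff f a \<noteq> 0 \<and> hcoeff g b \<noteq> 0}"
      by (rule conv_support_bound) (use l l' in auto)
    show "{q. q \<le> B \<and> ?h q \<noteq> 0}
      \<subseteq> {a + b | a b. a + b \<le> B \<and> hcoeff f a \<noteq> 0 \<and> hcoeff g b \<noteq> 0}"
    proof
      fix q assume q: "q \<in> {q. q \<le> B \<and> ?h q \<noteq> 0}"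
      then have "?h q \<noteq> 0" by simp
      then obtain p where "hcoeff f p \<noteq> 0" "hcoeff g (q - p) \<noteq> 0"
        by (rule sum.not_neutral_contains_not_neutral) auto
      then show "q \<in> {a + b | a b. a + b \<le> B \<and> hcoeff f a \<noteq> 0 \<and> hcoeff g b \<noteq> 0}"
        using q by (intro CollectI exI[of _ p] exI[of _ "q - p"]) auto
    qed
  qed
  then show ?thesis
    unfolding times_puiseux_hat_def by (subst Abs_puiseux_hat_inverse) auto
qed

lemma hcoeff_mult_sum:
  fixes f g :: "'a puiseux_hat"
  assumes "finite A" "finite B"
    and "\<And>a b. hcoeff f a \<noteq> 0 \<Longrightarrow> hcoeff g b \<noteq> 0 \<Longrightarrow> a + b = q \<Longrightarrow> a \<in> A \<and> b \<in> B"
  shows "hcoeff (f * g) q =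
    (\<Sum>a\<in>A. \<Sum>b\<in>B. if a + b = q then hcoeff f a * hcoeff g b else 0)"
proof -
  have inner: "(\<Sum>b\<in>B. if a + b = q then hcoeff f a * hcoeff g b else 0) =
      (if q - a \<in> B then hcoeff f a * hcoeff g (q - a) else 0)" for a
  proof -
    have "(a + b = q) = (b = q - a)" for b by (auto simp: algebra_simps)
    then have "(\<Sum>b\<in>B. if a + b = q then hcoeff f a * hcoeff g b else 0) =
       (\<Sum>b\<in>B. if b = q - a then hcoeff f a * hcoeff g b else 0)" by simp
    then show ?thesis using assms(2) by (simp add: sum.delta)
  qed
  have "hcoeff (f * g) q = (\<Sum>a\<in>A. if q - a \<in> B then hcoeff f a * hcoeff g (q - a) else 0)"
    unfolding hcoeff_mult
    by (rule sum.mono_neutral_cong_left) (use assms in \<open>auto simp: algebra_simps\<close>)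
  then show ?thesis by (simp add: inner)
qed

instance
proof
  fix f g h :: "'a puiseux_hat"
  obtain l1 where l1: "\<And>q. hcoeff f q \<noteq> 0 \<Longrightarrow> l1 \<le> q" using ex_lower_bound by blast
  obtain l2 where l2: "\<And>q. hcoeff g q \<noteq> 0 \<Longrightarrow> l2 \<le> q" using ex_lower_bound by blast
  obtain l3 where l3: "\<And>q. hcoeff h q \<noteq> 0 \<Longrightarrow> l3 \<le> q" using ex_lower_bound by blast
  define low where "low = (\<lambda>(f::'a puiseux_hat) B. {q. q \<le> B \<and> hcoeff f q \<noteq> 0})"
  have fl [simp]: "finite (low f B)" for f B unfolding low_def by (rule finite_below)
  have nz: "\<exists>a b. a + b = p \<and> hcoeff u a \<noteq> 0 \<and> hcoeff v b \<noteq> 0" if nn: "hcoeff (u * v) p \<noteq> 0"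
    for u v :: "'a puiseux_hat" and p
  proof -
    obtain a where "hcoeff u a \<noteq> 0" "hcoeff v (p - a) \<noteq> 0"
      using nn unfolding hcoeff_mult
      by (rule sum.not_neutral_contains_not_neutral) auto
    then show ?thesis by (intro exI[of _ a] exI[of _ "p - a"]) auto
  qed
  show comm: "f * g = g * f" for f g :: "'a puiseux_hat"
  proof (rule hat_eqI)
    fix q
    show "hcoeff (f * g) q = hcoeff (g * f) q"
      unfolding hcoeff_mult
      by (rule sum.reindex_bij_witness[of _ "\<lambda>p. q - p" "\<lambda>p. q - p"]) (auto simp: mult.commute)
  qed
  show "1 * f = f"
  proof (rule hat_eqI)
    fix q
    have "hcoeff (1 * f) q =
       (\<Sum>a\<in>{0}. \<Sum>b\<in>{q}. if a + b = q then hcoeff 1 a * hcoeff f b else 0)"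
      by (rule hcoeff_mult_sum) (auto simp: hcoeff_one split: if_splits)
    then show "hcoeff (1 * f) q = hcoeff f q" by (simp add: hcoeff_one)
  qed
  show "(0::'a puiseux_hat) \<noteq> 1"
    by (metis hcoeff_one hcoeff_zero zero_neq_one)
  show "(f + g) * h = f * h + g * h"
  proof (rule hat_eqI)
    fix q
    let ?A = "low f (q - l3) \<union> low g (q - l3)" and ?B = "low h (q - l1) \<union> low h (q - l2)"
    have A: "x \<in> ?A \<and> y \<in> ?B"
      if "hcoeff f x \<noteq> 0 \<or> hcoeff g x \<noteq> 0" "hcoeff h y \<noteq> 0" "x + y = q" for x y
      using that l1[of x] l2[of x] l3[of y] unfolding low_def by (auto simp: algebra_simps)
    have e1: "hcoeff ((f + g) * h) q =
      (\<Sum>a\<in>?A. \<Sum>b\<in>?B. if a + b = q then hcoeff (f + g) a * hcoeff h b else 0)"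
    proof (rule hcoeff_mult_sum)
      fix x y assume xy: "hcoeff (f + g) x \<noteq> 0" "hcoeff h y \<noteq> 0" "x + y = q"
      then have "hcoeff f x \<noteq> 0 \<or> hcoeff g x \<noteq> 0" by auto
      then show "x \<in> ?A \<and> y \<in> ?B" using A xy by blast
    qed auto
    have e2: "hcoeff (f * h) q =
      (\<Sum>a\<in>?A. \<Sum>b\<in>?B. if a + b = q then hcoeff f a * hcoeff h b else 0)"
      by (rule hcoeff_mult_sum) (use A in auto)
    have e3: "hcoeff (g * h) q =
      (\<Sum>a\<in>?A. \<Sum>b\<in>?B. if a + b = q then hcoeff g a * hcoeff h b else 0)"
      by (rule hcoeff_mult_sum) (use A in auto)
    show "hcoeff ((f + g) * h) q = hcoeff (f * h + g * h) q"
      unfolding hcoeff_add[of "f * h"] e1 e2 e3 sum.distrib[symmetric]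
      by (intro sum.cong refl) (simp add: distrib_right)
  qed
  show "f * g * h = f * (g * h)"
  proof (rule hat_eqI)
    fix q
    let ?A = "low f (q - l2 - l3)" and ?B = "low g (q - l1 - l3)" and ?C = "low h (q - l1 - l2)"
    let ?P = "(\<lambda>(a, b). a + b) ` (?A \<times> ?B)" and ?Q = "(\<lambda>(b, c). b + c) ` (?B \<times> ?C)"
    have ABC: "a \<in> ?A \<and> b \<in> ?B \<and> c \<in> ?C"
      if "hcoeff f a \<noteq> 0" "hcoeff g b \<noteq> 0" "hcoeff h c \<noteq> 0" "a + b + c = q" for a b c
      using that l1[of a] l2[of b] l3[of c] unfolding low_def by (auto simp: algebra_simps)
    have fg: "hcoeff (f * g) p =
       (\<Sum>a\<in>?A. \<Sum>b\<in>?B. if a + b = p then hcoeff f a * hcoeff g b else 0)"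
      if "hcoeff h c \<noteq> 0" "p + c = q" for p c
      by (rule hcoeff_mult_sum) (use ABC that in auto)
    have gh: "hcoeff (g * h) p =
       (\<Sum>b\<in>?B. \<Sum>c\<in>?C. if b + c = p then hcoeff g b * hcoeff h c else 0)"
      if "hcoeff f a \<noteq> 0" "a + p = q" for p a
      by (rule hcoeff_mult_sum) (use ABC that in \<open>auto simp: algebra_simps\<close>)
    have "hcoeff (f * g * h) q =
      (\<Sum>p\<in>?P. \<Sum>c\<in>?C. if p + c = q then hcoeff (f * g) p * hcoeff h c else 0)"
    proof (rule hcoeff_mult_sum)
      fix p c assume pc: "hcoeff (f * g) p \<noteq> 0" "hcoeff h c \<noteq> 0" "p + c = q"
      obtain a b where "a + b = p" "hcoeff f a \<noteq> 0" "hcoeff g b \<noteq> 0" using nz[OF pc(1)] by blast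
      then show "p \<in> ?P \<and> c \<in> ?C" using ABC[of a b c] pc by force
    qed auto
    also have "\<dots> = (\<Sum>p\<in>?P. \<Sum>c\<in>?C. \<Sum>a\<in>?A. \<Sum>b\<in>?B.
        if p = a + b then (if a + b + c = q then hcoeff f a * hcoeff g b * hcoeff h c else 0) else 0)"
    proof (intro sum.cong refl)
      fix p c assume "c \<in> ?C"
      then have "hcoeff h c \<noteq> 0" by (simp add: low_def)
      then have "(if p + c = q then hcoeff (f * g) p * hcoeff h c else 0) =
        (if p + c = q then (\<Sum>a\<in>?A. \<Sum>b\<in>?B. if a + b = p then hcoeff f a * hcoeff g b else 0) * hcoeff h c else 0)"
        using fg by auto
      also have "\<dots> = (\<Sum>a\<in>?A. \<Sum>b\<in>?B.
        if p = a + b then (if a + b + c = q then hcoeff f a * hcoeff g b * hcoeff h c else 0) else 0)"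
        by (auto simp: sum_distrib_right intro!: sum.cong sum.neutral)
      finally show "(if p + c = q then hcoeff (f * g) p * hcoeff h c else 0) = \<dots>" .
    qed
    also have "\<dots> = (\<Sum>a\<in>?A. \<Sum>b\<in>?B. \<Sum>c\<in>?C. \<Sum>p\<in>?P.
        if p = a + b then (if a + b + c = q then hcoeff f a * hcoeff g b * hcoeff h c else 0) else 0)"
    proof -
      define F where "F = (\<lambda>p c a b. if p = a + b then (if a + b + c = q then hcoeff f a * hcoeff g b * hcoeff h c else 0) else 0)"
      have "(\<Sum>p\<in>?P. \<Sum>c\<in>?C. \<Sum>a\<in>?A. \<Sum>b\<in>?B. F p c a b)
        = (\<Sum>c\<in>?C. \<Sum>p\<in>?P. \<Sum>a\<in>?A. \<Sum>b\<in>?B. F p c a b)" by (rule sum.swap)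
      also have "\<dots> = (\<Sum>c\<in>?C. \<Sum>a\<in>?A. \<Sum>p\<in>?P. \<Sum>b\<in>?B. F p c a b)"
        by (intro sum.cong refl sum.swap)
      also have "\<dots> = (\<Sum>c\<in>?C. \<Sum>a\<in>?A. \<Sum>b\<in>?B. \<Sum>p\<in>?P. F p c a b)"
        by (intro sum.cong refl sum.swap)
      also have "\<dots> = (\<Sum>a\<in>?A. \<Sum>c\<in>?C. \<Sum>b\<in>?B. \<Sum>p\<in>?P. F p c a b)"
        by (rule sum.swap)
      also have "\<dots> = (\<Sum>a\<in>?A. \<Sum>b\<in>?B. \<Sum>c\<in>?C. \<Sum>p\<in>?P. F p c a b)"
        by (intro sum.cong refl sum.swap)
      finally show ?thesis unfolding F_def .
    qed
    also have "\<dots> = (\<Sum>a\<in>?A. \<Sum>b\<in>?B. \<Sum>c\<in>?C.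
        if a + b + c = q then hcoeff f a * hcoeff g b * hcoeff h c else 0)"
    proof (intro sum.cong refl)
      fix a b c assume "a \<in> ?A" "b \<in> ?B"
      then have "a + b \<in> ?P" by force
      then show "(\<Sum>p\<in>?P. if p = a + b then (if a + b + c = q then hcoeff f a * hcoeff g b * hcoeff h c else 0) else 0)
        = (if a + b + c = q then hcoeff f a * hcoeff g b * hcoeff h c else 0)"
        by (subst sum.delta) auto
    qed
    finally have L: "hcoeff (f * g * h) q = (\<Sum>a\<in>?A. \<Sum>b\<in>?B. \<Sum>c\<in>?C.
        if a + b + c = q then hcoeff f a * hcoeff g b * hcoeff h c else 0)" .
    have "hcoeff (f * (g * h)) q =
      (\<Sum>a\<in>?A. \<Sum>p\<in>?Q. if a + p = q then hcoeff f a * hcoeff (g * h) p else 0)"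
    proof (rule hcoeff_mult_sum)
      fix a p assume pc: "hcoeff f a \<noteq> 0" "hcoeff (g * h) p \<noteq> 0" "a + p = q"
      obtain b c where "b + c = p" "hcoeff g b \<noteq> 0" "hcoeff h c \<noteq> 0" using nz[OF pc(2)] by blast
      then show "a \<in> ?A \<and> p \<in> ?Q" using ABC[of a b c] pc by (force simp: algebra_simps)
    qed auto
    also have "\<dots> = (\<Sum>a\<in>?A. \<Sum>p\<in>?Q. \<Sum>b\<in>?B. \<Sum>c\<in>?C.
        if p = b + c then (if a + b + c = q then hcoeff f a * hcoeff g b * hcoeff h c else 0) else 0)"
    proof (intro sum.cong refl)
      fix a p assume "a \<in> ?A"
      then have "hcoeff f a \<noteq> 0" by (simp add: low_def)
      then have "(if a + p = q then hcoeff f a * hcoeff (g * h) p else 0) =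
        (if a + p = q then hcoeff f a * (\<Sum>b\<in>?B. \<Sum>c\<in>?C. if b + c = p then hcoeff g b * hcoeff h c else 0) else 0)"
        using gh by auto
      also have "\<dots> = (\<Sum>b\<in>?B. \<Sum>c\<in>?C.
        if p = b + c then (if a + b + c = q then hcoeff f a * hcoeff g b * hcoeff h c else 0) else 0)"
        by (auto simp: sum_distrib_left mult.assoc add.assoc intro!: sum.cong sum.neutral)
      finally show "(if a + p = q then hcoeff f a * hcoeff (g * h) p else 0) = \<dots>" .
    qed
    also have "\<dots> = (\<Sum>a\<in>?A. \<Sum>b\<in>?B. \<Sum>c\<in>?C. \<Sum>p\<in>?Q.
        if p = b + c then (if a + b + c = q then hcoeff f a * hcoeff g b * hcoeff h c else 0) else 0)"
    proof (rule sum.cong[OF refl])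
      fix a
      define F where "F = (\<lambda>p b c. if p = b + c then (if a + b + c = q then hcoeff f a * hcoeff g b * hcoeff h c else 0) else 0)"
      have "(\<Sum>p\<in>?Q. \<Sum>b\<in>?B. \<Sum>c\<in>?C. F p b c) = (\<Sum>b\<in>?B. \<Sum>p\<in>?Q. \<Sum>c\<in>?C. F p b c)"
        by (rule sum.swap)
      also have "\<dots> = (\<Sum>b\<in>?B. \<Sum>c\<in>?C. \<Sum>p\<in>?Q. F p b c)"
        by (intro sum.cong refl sum.swap)
      finally show "(\<Sum>p\<in>?Q. \<Sum>b\<in>?B. \<Sum>c\<in>?C.
        if p = b + c then (if a + b + c = q then hcoeff f a * hcoeff g b * hcoeff h c else 0) else 0) =
        (\<Sum>b\<in>?B. \<Sum>c\<in>?C. \<Sum>p\<in>?Q.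
        if p = b + c then (if a + b + c = q then hcoeff f a * hcoeff g b * hcoeff h c else 0) else 0)"
        unfolding F_def .
    qed
    also have "\<dots> = (\<Sum>a\<in>?A. \<Sum>b\<in>?B. \<Sum>c\<in>?C.
        if a + b + c = q then hcoeff f a * hcoeff g b * hcoeff h c else 0)"
    proof (intro sum.cong refl)
      fix a b c assume "b \<in> ?B" "c \<in> ?C"
      then have "b + c \<in> ?Q" by force
      then show "(\<Sum>p\<in>?Q. if p = b + c then (if a + b + c = q then hcoeff f a * hcoeff g b * hcoeff h c else 0) else 0)
        = (if a + b + c = q then hcoeff f a * hcoeff g b * hcoeff h c else 0)"
        by (subst sum.delta) auto
    qed
    finally show "hcoeff (f * g * h) q = hcoeff (f * (g * h)) q" using L by simp
  qed
qed

end

lemma hcoeff_single_mult: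
  "hcoeff (hsingle q c * f) p = c * hcoeff f (p - q)" for f :: "'k::comm_ring_1 puiseux_hat"
proof -
  have "hcoeff (hsingle q c * f) p =
    (\<Sum>a\<in>{q}. \<Sum>b\<in>{p - q}. if a + b = p then hcoeff (hsingle q c) a * hcoeff f b else 0)"
    by (rule hcoeff_mult_sum) (auto simp: hcoeff_single split: if_splits)
  then show ?thesis by (simp add: hcoeff_single)
qed

lemma hsingle_mult: "hsingle p a * hsingle q b = hsingle (p + q) (a * b)"
  for a b :: "'k::comm_ring_1"
  by (rule hat_eqI) (auto simp: hcoeff_single_mult hcoeff_single algebra_simps)

lemma mult_lower_bound:
  fixes f g :: "'k::comm_ring_1 puiseux_hat"
  assumes "\<And>q. q < u \<Longrightarrow> hcoeff f q = 0" "\<And>q. q < v \<Longrightarrow> hcoeff g q = 0" "q < u + v"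
  shows "hcoeff (f * g) q = 0"
  unfolding hcoeff_mult
proof (rule sum.neutral, clarify)
  fix p assume "hcoeff f p \<noteq> 0" "hcoeff g (q - p) \<noteq> 0"
  then have "u \<le> p" "v \<le> q - p" using assms(1,2) by (meson not_le)+
  then show "hcoeff f p * hcoeff g (q - p) = 0" using assms(3) by linarith
qed

subsection \<open>Inverses\<close>

lemma ex_leading:
  assumes "f \<noteq> 0"
  shows "\<exists>q. hcoeff f q \<noteq> 0 \<and> (\<forall>p<q. hcoeff f p = 0)"
proof -
  obtain p where p: "hcoeff f p \<noteq> 0" using assms hat_eqI by (metis hcoeff_zero)
  let ?S = "{q. q \<le> p \<and> hcoeff f q \<noteq> 0}"
  have fin: "finite ?S" and ne: "?S \<noteq> {}" using finite_below p by auto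
  have M: "Min ?S \<in> ?S" using fin ne by (rule Min_in)
  have "hcoeff f r = 0" if "r < Min ?S" for r
  proof (rule ccontr)
    assume "hcoeff f r \<noteq> 0"
    moreover have "r \<le> p" using that M by auto
    ultimately have "Min ?S \<le> r" using fin by (intro Min_le) auto
    then show False using that by simp
  qed
  then show ?thesis using M by blast
qed

lemma geometric_inverse:
  fixes g :: "'k::comm_ring_1 puiseux_hat"
  assumes v: "v > 0" and g: "\<And>q. q < v \<Longrightarrow> hcoeff g q = 0"
  shows "\<exists>s. s * (1 - g) = 1"
proof -
  have pw: "hcoeff (g ^ n) q = 0" if "q < of_nat n * v" for n q
    using that
  proof (induction n arbitrary: q)
    case 0
    then show ?case by (simp add: hcoeff_one)
  next
    case (Suc n)
    show ?case unfolding power_Suc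
      by (rule mult_lower_bound[of v _ "of_nat n * v"])
        (use g Suc in \<open>auto simp: algebra_simps\<close>)
  qed
  define N where "N q = nat \<lceil>q / v\<rceil>" for q
  have N: "q < of_nat n * v" if "n > N q" for n q
  proof -
    have "q / v \<le> of_nat (N q)" unfolding N_def by linarith
    also have "\<dots> < of_nat n" using that by simp
    finally show ?thesis using v by (simp add: field_simps)
  qed
  define S where "S n = (\<Sum>i\<le>n. g ^ i)" for n
  have Sst: "hcoeff (S n) q = hcoeff (S (N q)) q" if "n \<ge> N q" for n q
    unfolding S_def hcoeff_sum
    by (rule sum.mono_neutral_right) (use that pw N in \<open>auto simp: not_le\<close>)
  have Nmono: "N q \<le> N B" if "q \<le> B" for q B
    unfolding N_def using that v by (intro nat_mono ceiling_mono divide_right_mono) auto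
  define s where "s = Abs_puiseux_hat (\<lambda>q. hcoeff (S (N q)) q)"
  have sc: "hcoeff s q = hcoeff (S (N q)) q" for q
  proof -
    have "finite {q. q \<le> B \<and> hcoeff (S (N q)) q \<noteq> 0}" for B
    proof (rule finite_subset[OF _ finite_below[of B "S (N B)"]], rule subsetI)
      fix q assume "q \<in> {q. q \<le> B \<and> hcoeff (S (N q)) q \<noteq> 0}"
      then show "q \<in> {q. q \<le> B \<and> hcoeff (S (N B)) q \<noteq> 0}" using Sst[OF Nmono[of q B]] by simp
    qed
    then show ?thesis unfolding s_def by (subst Abs_puiseux_hat_inverse) auto
  qed
  have tele: "S n * (1 - g) = 1 - g ^ Suc n" for n
  proof (induction n)
    case (Suc n)
    have "S (Suc n) = S n + g ^ Suc n" by (simp add: S_def)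
    then have "S (Suc n) * (1 - g) = (1 - g ^ Suc n) + g ^ Suc n * (1 - g)"
      using Suc by (simp only: distrib_right)
    then show ?case by (simp add: algebra_simps)
  qed (simp add: S_def)
  have "s * (1 - g) = 1"
  proof (rule hat_eqI)
    fix q
    define n where "n = N q"
    have "hcoeff ((s - S n) * (1 - g)) q = 0"
    proof (rule mult_lower_bound[of "of_nat (Suc n) * v" _ 0])
      fix p assume p: "p < of_nat (Suc n) * v"
      have "N p \<le> Suc n"
      proof -
        have "p / v < of_nat (Suc n)" using p v by (simp add: field_simps)
        then have "\<lceil>p / v\<rceil> \<le> int (Suc n)" by (intro ceiling_le) auto
        then show ?thesis unfolding N_def by linarith
      qed
      then have "hcoeff s p = hcoeff (S (Suc n)) p" by (simp only: sc Sst[of p "Suc n"])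
      also have "\<dots> = hcoeff (S n) p + hcoeff (g ^ Suc n) p" by (simp add: S_def)
      also have "hcoeff (g ^ Suc n) p = 0" using pw p by blast
      finally show "hcoeff (s - S n) p = 0" by simp
    next
      fix p :: rat assume "p < 0"
      then show "hcoeff (1 - g) p = 0" using g v by (simp add: hcoeff_one)
    next
      show "q < of_nat (Suc n) * v + 0" using N[of q "Suc n"] by (simp add: n_def)
    qed
    moreover have "hcoeff (g ^ Suc n) q = 0" by (rule pw, rule N) (simp add: n_def)
    ultimately show "hcoeff (s * (1 - g)) q = hcoeff 1 q"
      using tele[of n] by (simp add: left_diff_distrib)
  qed
  then show ?thesis by blast
qed

lemma ex_inverse:
  fixes f :: "'k::field puiseux_hat"
  assumes "f \<noteq> 0"
  shows "\<exists>g. g * f = 1"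
proof -
  obtain q where q: "hcoeff f q \<noteq> 0" "\<And>p. p < q \<Longrightarrow> hcoeff f p = 0"
    using ex_leading[OF assms] by blast
  define m where "m = hsingle (- q) (inverse (hcoeff f q))"
  define g where "g = 1 - m * f"
  have gc: "hcoeff g p = (if p = 0 then 0 else - (inverse (hcoeff f q) * hcoeff f (p + q)))" for p
    using q by (simp add: g_def m_def hcoeff_one hcoeff_single_mult)
  have "\<exists>v>0. \<forall>p<v. hcoeff g p = 0"
  proof (cases "g = 0")
    case True
    then show ?thesis by (intro exI[of _ 1]) simp
  next
    case False
    obtain v where v: "hcoeff g v \<noteq> 0" "\<And>p. p < v \<Longrightarrow> hcoeff g p = 0"
      using ex_leading[OF False] by blast
    have "v > 0"
    proof (rule ccontr)
      assume "\<not> v > 0"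
      then have "v = 0 \<or> v + q < q" by auto
      then show False using v(1) q(2) gc[of v] by (auto split: if_splits)
    qed
    then show ?thesis using v by blast
  qed
  then obtain s where "s * (1 - g) = 1" using geometric_inverse by metis
  then have "(s * m) * f = 1" by (simp add: g_def mult.assoc)
  then show ?thesis by blast
qed

instantiation puiseux_hat :: (field) field
begin

definition inverse_puiseux_hat_def: "inverse (f :: 'a puiseux_hat) = (if f = 0 then 0 else SOME g. g * f = 1)"

definition divide_puiseux_hat_def: "f div (g :: 'a puiseux_hat) = f * inverse g"

instance
proof
  fix f g :: "'a puiseux_hat"
  show "f \<noteq> 0 \<Longrightarrow> inverse f * f = 1"
    unfolding inverse_puiseux_hat_def using someI_ex[OF ex_inverse[of f]] by simp
  show "f div g = f * inverse g" by (rule divide_puiseux_hat_def)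
  show "inverse (0::'a puiseux_hat) = 0" by (simp add: inverse_puiseux_hat_def)
qed

end

subsection \<open>The subfield of Puiseux series and the absolute value\<close>

text \<open>The series \<open>F(x\<^sup>1\<^sup>/\<^sup>n)\<close> for a formal Laurent series \<open>F\<close> and \<open>n > 0\<close>.\<close>

lift_definition laurent :: "nat \<Rightarrow> 'k::zero fls \<Rightarrow> 'k puiseux_hat"
  is "\<lambda>n F q. if n > 0 \<and> of_nat n * q \<in> \<int> then fls_nth F \<lfloor>of_nat n * q\<rfloor> else 0"
proof -
  fix n F and B :: rat
  let ?f = "\<lambda>q::rat. if n > 0 \<and> of_nat n * q \<in> \<int> then fls_nth F \<lfloor>of_nat n * q\<rfloor> else (0::'k)"
  show "finite {q. q \<le> B \<and> ?f q \<noteq> 0}"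
  proof (rule finite_subset)
    show "finite ((\<lambda>j. of_int j / of_nat n) ` {fls_subdegree F..\<lfloor>of_nat n * B\<rfloor>} :: rat set)"
      by simp
    show "{q. q \<le> B \<and> ?f q \<noteq> 0}
      \<subseteq> (\<lambda>j. of_int j / of_nat n) ` {fls_subdegree F..\<lfloor>of_nat n * B\<rfloor>}"
    proof
      fix q assume "q \<in> {q. q \<le> B \<and> ?f q \<noteq> 0}"
      then have q: "q \<le> B" "n > 0" "of_nat n * q \<in> \<int>" "fls_nth F \<lfloor>of_nat n * q\<rfloor> \<noteq> 0"
        by (auto split: if_splits)
      then have "of_nat n * q \<le> of_nat n * B" by simp
      then have "\<lfloor>of_nat n * q\<rfloor> \<le> \<lfloor>of_nat n * B\<rfloor>" by (rule floor_mono)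
      moreover have "fls_subdegree F \<le> \<lfloor>of_nat n * q\<rfloor>"
        using q(4) by (rule fls_subdegree_leI)
      moreover have "q = of_int \<lfloor>of_nat n * q\<rfloor> / of_nat n"
        using q(2,3) by (simp add: field_simps)
      ultimately show "q \<in> (\<lambda>j. of_int j / of_nat n) ` {fls_subdegree F..\<lfloor>of_nat n * B\<rfloor>}"
        by (intro image_eqI[of _ _ "\<lfloor>of_nat n * q\<rfloor>"]) auto
    qed
  qed
qed

definition puiseux :: "'k::zero puiseux_hat set"
  where "puiseux = (\<Union>n\<in>{1..}. range (laurent n))"

lemma range_laurent:
  assumes "n > 0"
  shows "range (laurent n) = {f :: 'k::zero puiseux_hat. \<forall>q. hcoeff f q \<noteq> 0 \<longrightarrow> of_nat n * q \<in> \<int>}"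
proof (intro equalityI subsetI CollectI)
  fix f :: "'k puiseux_hat" assume "f \<in> range (laurent n)"
  then show "\<forall>q. hcoeff f q \<noteq> 0 \<longrightarrow> of_nat n * q \<in> \<int>"
    by (auto simp: laurent.rep_eq split: if_splits)
next
  fix f :: "'k puiseux_hat"
  assume f: "f \<in> {f. \<forall>q. hcoeff f q \<noteq> 0 \<longrightarrow> of_nat n * q \<in> \<int>}"
  obtain l where l: "\<And>q. hcoeff f q \<noteq> 0 \<Longrightarrow> l \<le> q" using ex_lower_bound by blast
  define F where "F = Abs_fls (\<lambda>j. hcoeff f (of_int j / of_nat n))"
  have "\<forall>\<^sub>\<infinity>m. hcoeff f (of_int (- int m) / of_nat n) = 0"
    unfolding MOST_nat
  proof (intro exI allI impI)
    fix m assume "nat \<lceil>- (l * of_nat n)\<rceil> < m"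
    then have "- (l * of_nat n) < of_nat m" by linarith
    then have "of_int (- int m) / of_nat n < l" using assms by (simp add: field_simps)
    then show "hcoeff f (of_int (- int m) / of_nat n) = 0" using l by (meson not_le)
  qed
  then have F: "fls_nth F j = hcoeff f (of_int j / of_nat n)" for j
    unfolding F_def by (subst nth_Abs_fls) auto
  have "f = laurent n F"
  proof (rule hat_eqI)
    fix q
    show "hcoeff f q = hcoeff (laurent n F) q"
      using f assms by (auto simp: laurent.rep_eq F)
  qed
  then show "f \<in> range (laurent n)" by blast
qed

text \<open>The \<open>x\<close>-adic valuation of a nonzero series, and the absolute value with \<open>|x| = r\<close>.\<close>

definition hval :: "'k::zero puiseux_hat \<Rightarrow> rat"
  where "hval f = (THE q. hcoeff f q \<noteq> 0 \<and> (\<forall>p<q. hcoeff f p = 0))"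

definition habs :: "real \<Rightarrow> 'k::zero puiseux_hat \<Rightarrow> real"
  where "habs r f = (if f = 0 then 0 else r powr real_of_rat (hval f))"

definition hdist :: "real \<Rightarrow> 'k::ab_group_add puiseux_hat \<Rightarrow> 'k puiseux_hat \<Rightarrow> real"
  where "hdist r f g = habs r (f - g)"

abbreviation htopology :: "real \<Rightarrow> 'k::ab_group_add puiseux_hat topology"
  where "htopology r \<equiv> Metric_space.mtopology UNIV (hdist r)"

lemma hval:
  assumes "f \<noteq> 0"
  shows "hcoeff f (hval f) \<noteq> 0" "p < hval f \<Longrightarrow> hcoeff f p = 0"
proof -
  obtain q where q: "hcoeff f q \<noteq> 0 \<and> (\<forall>p<q. hcoeff f p = 0)" using ex_leading[OF assms] by blast
  have *: "hcoeff f (hval f) \<noteq> 0 \<and> (\<forall>p<hval f. hcoeff f p = 0)"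
    unfolding hval_def
  proof (rule theI)
    show "hcoeff f q \<noteq> 0 \<and> (\<forall>p<q. hcoeff f p = 0)" by (rule q)
    fix t assume "hcoeff f t \<noteq> 0 \<and> (\<forall>p<t. hcoeff f p = 0)"
    then show "t = q" using q by (meson linorder_neqE)
  qed
  then show "hcoeff f (hval f) \<noteq> 0" "p < hval f \<Longrightarrow> hcoeff f p = 0" by auto
qed

lemma hval_le: "hcoeff f q \<noteq> 0 \<Longrightarrow> hval f \<le> q"
  using hval(2)[of f q] by (metis hcoeff_zero not_le)

lemma hval_eqI:
  assumes "hcoeff f q \<noteq> 0" "\<And>p. p < q \<Longrightarrow> hcoeff f p = 0"
  shows "hval f = q"
  using assms hval_le hval by (metis hcoeff_zero leD linorder_neqE)

lemma habs_nonneg: "0 \<le> habs r f"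
  by (simp add: habs_def)

lemma habs_mult:
  fixes f g :: "'k::field puiseux_hat"
  shows "habs r (f * g) = habs r f * habs r g"
proof (cases "f = 0 \<or> g = 0")
  case True
  then show ?thesis by (auto simp: habs_def)
next
  case False
  then have f: "f \<noteq> 0" and g: "g \<noteq> 0" by auto
  have "{p. hcoeff f p \<noteq> 0 \<and> hcoeff g (hval f + hval g - p) \<noteq> 0} = {hval f}"
  proof (intro equalityI subsetI)
    fix p assume "p \<in> {p. hcoeff f p \<noteq> 0 \<and> hcoeff g (hval f + hval g - p) \<noteq> 0}"
    then have "hval f \<le> p" "hval g \<le> hval f + hval g - p"
      using hval_le[of f p] hval_le[of g "hval f + hval g - p"] by auto
    then show "p \<in> {hval f}" by auto
  qed (use hval(1)[OF f] hval(1)[OF g] in auto)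
  then have "hcoeff (f * g) (hval f + hval g) \<noteq> 0"
    unfolding hcoeff_mult using hval(1)[OF f] hval(1)[OF g] by simp
  moreover have "hcoeff (f * g) q = 0" if "q < hval f + hval g" for q
    by (rule mult_lower_bound[of "hval f" _ "hval g"]) (use hval(2)[OF f] hval(2)[OF g] that in auto)
  ultimately have "hval (f * g) = hval f + hval g" by (rule hval_eqI)
  then show ?thesis
    using False by (simp add: habs_def powr_add of_rat_add)
qed

lemma habs_less_iff:
  assumes "0 < r" "r < 1"
  shows "habs r f < r powr real_of_rat B \<longleftrightarrow> (\<forall>q\<le>B. hcoeff f q = 0)"
proof (cases "f = 0")
  case True
  then show ?thesis using assms by (auto simp: habs_def)
next
  case False
  have "habs r f < r powr real_of_rat B \<longleftrightarrow> B < hval f"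
    using False assms powr_less_cancel_iff[of "1 / r"]
    by (auto simp: habs_def powr_divide field_simps of_rat_less)
  also have "\<dots> \<longleftrightarrow> (\<forall>q\<le>B. hcoeff f q = 0)"
    using hval[OF False] by (meson le_less_trans not_le)
  finally show ?thesis .
qed

lemma habs_add_le:
  fixes f g :: "'k::ab_group_add puiseux_hat"
  assumes "0 < r" "r < 1"
  shows "habs r (f + g) \<le> max (habs r f) (habs r g)"
proof (cases "f + g = 0")
  case True
  then show ?thesis using habs_nonneg[of r f] by (simp add: habs_def)
next
  case False
  have *: "r powr real_of_rat (hval (f + g)) \<le> habs r u"
    if "hcoeff u (hval (f + g)) \<noteq> 0" for u :: "'k puiseux_hat"
    using habs_less_iff[OF assms, of u "hval (f + g)"] that by force
  have "hcoeff f (hval (f + g)) \<noteq> 0 \<or> hcoeff g (hval (f + g)) \<noteq> 0"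
    using hval(1)[OF False] by auto
  then have "r powr real_of_rat (hval (f + g)) \<le> max (habs r f) (habs r g)"
    using *[of f] *[of g] by auto
  then show ?thesis using False by (simp add: habs_def)
qed

lemma habs_uminus: "habs r (- f) = habs r f" for f :: "'k::ab_group_add puiseux_hat"
  by (auto simp: habs_def hval_def)

lemma metric_space_hdist:
  assumes "0 < r" "r < 1"
  shows "Metric_space UNIV (hdist r :: 'k::ab_group_add puiseux_hat \<Rightarrow> _)"
proof
  fix f g h :: "'k puiseux_hat"
  show "0 \<le> hdist r f g" by (simp add: hdist_def habs_nonneg)
  show "hdist r f g = hdist r g f"
    unfolding hdist_def using habs_uminus[of r "f - g"] by simp
  show "hdist r f g = 0 \<longleftrightarrow> f = g"
    using assms by (auto simp: hdist_def habs_def)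
  have "hdist r f h \<le> max (hdist r f g) (hdist r g h)"
    unfolding hdist_def using habs_add_le[OF assms, of "f - g" "g - h"] by simp
  also have "\<dots> \<le> hdist r f g + hdist r g h"
    by (simp add: hdist_def habs_nonneg)
  finally show "hdist r f h \<le> hdist r f g + hdist r g h" .
qed

lemma ex_powr_less:
  fixes r e :: real
  assumes "0 < r" "r < 1" "0 < e"
  shows "\<exists>n::nat. r powr real_of_rat (of_nat n) < e"
  using real_arch_pow_inv[OF assms(3,2)] assms(1) by (simp add: powr_realpow)

lemma ex_common_denominator:
  assumes "finite T"
  shows "\<exists>n>0. \<forall>q\<in>T. of_nat n * q \<in> (\<int> :: rat set)"
  using assms
proof induction
  case (insert q T)
  then obtain n where n: "n > 0" "\<forall>q\<in>T. of_nat n * q \<in> \<int>" by blast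
  obtain a b where ab: "b > 0" "q = of_int a / of_int b"
    by (metis Fract_of_int_quotient Rat_cases)
  have "of_nat (n * nat b) * q \<in> \<int>"
  proof -
    have "of_nat (n * nat b) * q = of_int (int n * a)" using ab by (simp add: field_simps)
    then show ?thesis by (metis Ints_of_int)
  qed
  moreover have "of_nat (n * nat b) * p \<in> \<int>" if "p \<in> T" for p
  proof -
    have "of_nat (n * nat b) * p = of_nat (nat b) * (of_nat n * p)" by simp
    then show ?thesis using n(2) that by (metis Ints_mult Ints_of_nat)
  qed
  moreover have "n * nat b > 0" using n(1) ab(1) by simp
  ultimately show ?case by blast
qed auto

theorem puiseux_dense:
  assumes "0 < r" "r < 1"
  shows "htopology r closure_of (puiseux :: 'k::ab_group_add puiseux_hat set) = UNIV"
proof -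
  interpret Metric_space UNIV "hdist r :: 'k puiseux_hat \<Rightarrow> _" by (rule metric_space_hdist[OF assms])
  have "\<exists>g\<in>puiseux. hdist r f g < e" if e: "e > 0" for f :: "'k puiseux_hat" and e
  proof -
    obtain B :: nat where B: "r powr real_of_rat (of_nat B) < e" using ex_powr_less[OF assms e] by blast
    define g where "g = Abs_puiseux_hat (\<lambda>q. if q \<le> of_nat B then hcoeff f q else 0)"
    have gc: "hcoeff g q = (if q \<le> of_nat B then hcoeff f q else 0)" for q
    proof -
      have "finite {q. q \<le> C \<and> (if q \<le> of_nat B then hcoeff f q else 0) \<noteq> 0}" for C
        by (rule finite_subset[OF _ finite_below[of C f]]) auto
      then show ?thesis unfolding g_def by (subst Abs_puiseux_hat_inverse) auto
    qed
    obtain n where n: "n > 0" "\<forall>q\<in>{q. q \<le> of_nat B \<and> hcoeff f q \<noteq> 0}. of_nat n * q \<in> \<int>"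
      using ex_common_denominator[OF finite_below] by blast
    then have "g \<in> range (laurent n)" unfolding range_laurent[OF n(1)] by (auto simp: gc)
    then have "g \<in> puiseux" using n(1) by (force simp: puiseux_def)
    moreover have "hdist r f g < r powr real_of_rat (of_nat B)"
      unfolding hdist_def habs_less_iff[OF assms] by (simp add: gc)
    ultimately show ?thesis using B by (meson less_trans)
  qed
  then show ?thesis by (auto simp: metric_closure_of in_mball)
qed

theorem puiseux_hat_complete:
  assumes "0 < r" "r < 1"
  shows "Metric_space.mcomplete UNIV (hdist r :: 'k::ab_group_add puiseux_hat \<Rightarrow> _)"
proof -
  interpret Metric_space UNIV "hdist r :: 'k puiseux_hat \<Rightarrow> _" by (rule metric_space_hdist[OF assms])
  show ?thesis
    unfolding mcomplete_def
  proof (intro allI impI)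
    fix s :: "nat \<Rightarrow> 'k puiseux_hat" assume s: "MCauchy s"
    have "\<exists>N. \<forall>m\<ge>N. \<forall>q\<le>B. hcoeff (s m) q = hcoeff (s N) q" for B :: rat
    proof -
      have "r powr real_of_rat B > 0" using assms by simp
      then obtain N where N: "\<And>n n'. N \<le> n \<Longrightarrow> N \<le> n' \<Longrightarrow> hdist r (s n) (s n') < r powr real_of_rat B"
        using s unfolding MCauchy_def by meson
      have "hcoeff (s m) q = hcoeff (s N) q" if "m \<ge> N" "q \<le> B" for m q
        using N[OF that(1) order_refl] that(2)
        unfolding hdist_def habs_less_iff[OF assms] by auto
      then show ?thesis by blast
    qed
    then obtain N where N: "\<And>B m q. m \<ge> N B \<Longrightarrow> q \<le> B \<Longrightarrow> hcoeff (s m) q = hcoeff (s (N B)) q"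
      by metis
    define f where "f = Abs_puiseux_hat (\<lambda>q. hcoeff (s (N q)) q)"
    have same: "hcoeff (s (N q)) q = hcoeff (s (N B)) q" if "q \<le> B" for q B
      using N[of q "max (N q) (N B)" q] N[of B "max (N q) (N B)" q] that by simp
    have fc: "hcoeff f q = hcoeff (s (N q)) q" for q
    proof -
      have "finite {q. q \<le> B \<and> hcoeff (s (N q)) q \<noteq> 0}" for B
      proof (rule finite_subset[OF _ finite_below[of B "s (N B)"]], rule subsetI)
        fix q assume "q \<in> {q. q \<le> B \<and> hcoeff (s (N q)) q \<noteq> 0}"
        then show "q \<in> {q. q \<le> B \<and> hcoeff (s (N B)) q \<noteq> 0}" using same[of q B] by simp
      qed
      then show ?thesis unfolding f_def by (subst Abs_puiseux_hat_inverse) auto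
    qed
    have "\<exists>M. \<forall>m\<ge>M. hdist r (s m) f < e" if e: "e > 0" for e
    proof -
      obtain B :: nat where B: "r powr real_of_rat (of_nat B) < e" using ex_powr_less[OF assms e] by blast
      have "hdist r (s m) f < r powr real_of_rat (of_nat B)" if "m \<ge> N (of_nat B)" for m
        unfolding hdist_def habs_less_iff[OF assms]
        using N[OF that] same[of _ "of_nat B"] by (simp add: fc)
      then show ?thesis using B by (meson less_trans)
    qed
    then have "limitin mtopology s f sequentially"
      by (auto simp: limit_metric_sequentially)
    then show "\<exists>f. limitin mtopology s f sequentially" by blast
  qed
qed

section \<open>Galois action\<close>

definition is_ring_hom :: "('a::comm_ring_1 \<Rightarrow> 'b::comm_ring_1) \<Rightarrow> bool"
  where "is_ring_hom \<sigma> \<longleftrightarrow> \<sigma> 1 = 1 \<and>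
    (\<forall>a b. \<sigma> (a + b) = \<sigma> a + \<sigma> b) \<and> (\<forall>a b. \<sigma> (a * b) = \<sigma> a * \<sigma> b)"

text \<open>
  The group \<open>Gal(puiseux / k((x)))\<close>, each element being represented by its isometric
  extension to the completion (which exists, and is unique by density).
\<close>

definition galois :: "real \<Rightarrow> ('k::field puiseux_hat \<Rightarrow> 'k puiseux_hat) set"
  where "galois r = {\<sigma>. bij \<sigma> \<and> is_ring_hom \<sigma> \<and> \<sigma> ` puiseux = puiseux \<and>
    (\<forall>f\<in>range (laurent 1). \<sigma> f = f) \<and> (\<forall>f. habs r (\<sigma> f) = habs r f)}"

type_synonym 'k ratfun = "'k puiseux_hat poly fract"

definition rconst :: "'k::field puiseux_hat \<Rightarrow> 'k ratfun"
  where "rconst c = Fraction_Field.Fract [:c:] 1"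

definition rvar :: "'k::field ratfun"
  where "rvar = Fraction_Field.Fract [:0, 1:] 1"

text \<open>The subfield of rational functions in \<open>y\<close> over the (uncompleted) field of Puiseux series.\<close>

definition puiseux_ratfun :: "'k::field ratfun set"
  where "puiseux_ratfun = {Fraction_Field.Fract P Q | P Q.
    Q \<noteq> 0 \<and> (\<forall>i. poly.coeff P i \<in> puiseux) \<and> (\<forall>i. poly.coeff Q i \<in> puiseux)}"

text \<open>The action of a field automorphism on the coefficients of a rational function.\<close>

definition ratfun_map :: "('k::field puiseux_hat \<Rightarrow> 'k puiseux_hat) \<Rightarrow> 'k ratfun \<Rightarrow> 'k ratfun"
  where "ratfun_map \<sigma> f = (THE g. \<exists>P Q. Q \<noteq> 0 \<and> f = Fraction_Field.Fract P Q \<and>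
    g = Fraction_Field.Fract (map_poly \<sigma> P) (map_poly \<sigma> Q))"

lemma ratfun_map_Fract:
  assumes \<sigma>: "is_ring_hom \<sigma>" and Q: "Q \<noteq> 0"
  shows "ratfun_map \<sigma> (Fraction_Field.Fract P Q) =
    Fraction_Field.Fract (map_poly \<sigma> P) (map_poly \<sigma> Q)"
proof -
  have zero: "\<sigma> 0 = 0" using \<sigma> unfolding is_ring_hom_def by (metis add_cancel_right_right)
  have nz: "\<sigma> c \<noteq> 0" if "c \<noteq> 0" for c
    using \<sigma> zero that unfolding is_ring_hom_def by (metis mult_zero_left right_inverse zero_neq_one)
  have mult: "map_poly \<sigma> (A * B) = map_poly \<sigma> A * map_poly \<sigma> B" for A B
  proof (rule poly_eqI)
    fix n
    have "\<sigma> (\<Sum>i\<in>S. F i) = (\<Sum>i\<in>S. \<sigma> (F i))" for S :: "nat set" and F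
      using \<sigma> zero by (induction S rule: infinite_finite_induct) (auto simp: is_ring_hom_def)
    then show "poly.coeff (map_poly \<sigma> (A * B)) n = poly.coeff (map_poly \<sigma> A * map_poly \<sigma> B) n"
      using \<sigma> zero by (simp add: coeff_map_poly coeff_mult is_ring_hom_def)
  qed
  have pnz: "map_poly \<sigma> A \<noteq> 0" if "A \<noteq> 0" for A
    using that nz zero by (metis coeff_map_poly leading_coeff_0_iff coeff_0)
  show ?thesis
    unfolding ratfun_map_def
  proof (rule the_equality)
    show "\<exists>P' Q'. Q' \<noteq> 0 \<and> Fraction_Field.Fract P Q = Fraction_Field.Fract P' Q' \<and>
      Fraction_Field.Fract (map_poly \<sigma> P) (map_poly \<sigma> Q) =
      Fraction_Field.Fract (map_poly \<sigma> P') (map_poly \<sigma> Q')"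
      using Q by blast
    fix g assume "\<exists>P' Q'. Q' \<noteq> 0 \<and> Fraction_Field.Fract P Q = Fraction_Field.Fract P' Q' \<and>
      g = Fraction_Field.Fract (map_poly \<sigma> P') (map_poly \<sigma> Q')"
    then obtain P' Q' where Q': "Q' \<noteq> 0" "Fraction_Field.Fract P Q = Fraction_Field.Fract P' Q'"
      "g = Fraction_Field.Fract (map_poly \<sigma> P') (map_poly \<sigma> Q')" by blast
    then have "P * Q' = P' * Q" using Q by (simp add: eq_fract)
    then have "map_poly \<sigma> P * map_poly \<sigma> Q' = map_poly \<sigma> P' * map_poly \<sigma> Q" by (metis mult)
    then show "g = Fraction_Field.Fract (map_poly \<sigma> P) (map_poly \<sigma> Q)"
      using Q' Q pnz by (simp add: eq_fract)
  qed
qed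

section \<open>The Berkovich projective line\<close>

text \<open>
  A point \<open>\<zeta>\<close> is represented by the function \<open>f \<mapsto> \<parallel>f\<parallel>\<^sub>\<zeta> \<in> [0,\<infinity>]\<close> on rational functions in the coordinate
  \<open>y\<close>. The points other than \<open>\<infinity>\<close> are the multiplicative seminorms on polynomials extending
  the absolute value, with \<open>\<parallel>P/Q\<parallel> = \<parallel>P\<parallel>/\<parallel>Q\<parallel>\<close> whenever \<open>\<parallel>Q\<parallel> \<noteq> 0\<close>, and \<open>\<parallel>f\<parallel> = \<infinity>\<close> if \<open>f\<close>
  has no such representation, that is, if \<open>f\<close> has a pole at \<open>\<zeta>\<close>. The infima below range over
  sets with at most one element and so merely select this value.
\<close>

definition mult_seminorm :: "real \<Rightarrow> ('k::field puiseux_hat poly \<Rightarrow> real) \<Rightarrow> bool"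
  where "mult_seminorm r s \<longleftrightarrow> (\<forall>P. 0 \<le> s P) \<and> (\<forall>P Q. s (P + Q) \<le> s P + s Q) \<and>
    (\<forall>P Q. s (P * Q) = s P * s Q) \<and> (\<forall>c. s [:c:] = habs r c)"

definition ratfun_seminorm :: "('k::field puiseux_hat poly \<Rightarrow> real) \<Rightarrow> 'k ratfun \<Rightarrow> ennreal"
  where "ratfun_seminorm s f =
    Inf {ennreal (s P / s Q) | P Q. f = Fraction_Field.Fract P Q \<and> s Q \<noteq> 0}"

text \<open>The point \<open>\<infinity>\<close>: the absolute value of \<open>f(\<infinity>)\<close>, equal to \<open>\<infinity>\<close> at a pole.\<close>

definition berk_infinity :: "real \<Rightarrow> 'k::field ratfun \<Rightarrow> ennreal"
  where "berk_infinity r f =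
    Inf {ennreal (habs r (poly.coeff P (degree Q) / lead_coeff Q)) | P Q.
      f = Fraction_Field.Fract P Q \<and> Q \<noteq> 0 \<and> degree P \<le> degree Q}"

definition berk_line :: "real \<Rightarrow> ('k::field ratfun \<Rightarrow> ennreal) set"
  where "berk_line r = ratfun_seminorm ` {s. mult_seminorm r s} \<union> {berk_infinity r}"

lemma ratfun_seminorm_Fract:
  fixes P Q :: "'k::field puiseux_hat poly"
  assumes s: "mult_seminorm r s" and Q: "s Q \<noteq> 0"
  shows "ratfun_seminorm s (Fraction_Field.Fract P Q) = ennreal (s P / s Q)"
proof -
  have nz: "B \<noteq> 0" if "s B \<noteq> 0" for B
  proof
    assume "B = 0"
    moreover have "s [:0:] = habs r (0 :: 'k puiseux_hat)" using s unfolding mult_seminorm_def by blast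
    ultimately have "s B = habs r (0 :: 'k puiseux_hat)" by simp
    then show False using that by (simp add: habs_def)
  qed
  have "s P' / s Q' = s P / s Q"
    if "Fraction_Field.Fract P Q = Fraction_Field.Fract P' Q'" "s Q' \<noteq> 0" for P' Q'
  proof -
    have "P * Q' = P' * Q" using that Q nz by (simp add: eq_fract)
    then have "s (P * Q') = s (P' * Q)" by simp
    then have "s P * s Q' = s P' * s Q" using s by (simp add: mult_seminorm_def)
    then show ?thesis using Q that(2) by (simp add: field_simps)
  qed
  then have "{ennreal (s P' / s Q') | P' Q'.
      Fraction_Field.Fract P Q = Fraction_Field.Fract P' Q' \<and> s Q' \<noteq> 0} = {ennreal (s P / s Q)}"
    (is "?L = _")
  proof (intro equalityI subsetI)
    fix t assume "t \<in> {ennreal (s P / s Q)}"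
    then show "t \<in> ?L" using Q by blast
  qed fastforce
  then show ?thesis unfolding ratfun_seminorm_def by simp
qed

lemma berk_infinity_Fract:
  assumes Q: "Q \<noteq> 0"
  shows "berk_infinity r (Fraction_Field.Fract P Q) =
    (if degree P \<le> degree Q then ennreal (habs r (poly.coeff P (degree Q) / lead_coeff Q)) else top)"
proof -
  have deg: "degree P + degree Q' = degree P' + degree Q"
    if "P * Q' = P' * Q" "Q' \<noteq> 0" "P \<noteq> 0" for P' Q'
  proof -
    have "P' \<noteq> 0" using that Q by auto
    then show ?thesis using that Q degree_mult_eq[of P Q'] degree_mult_eq[of P' Q] by simp
  qed
  have val: "poly.coeff P' (degree Q') / lead_coeff Q' = poly.coeff P (degree Q) / lead_coeff Q"
    if e: "P * Q' = P' * Q" "Q' \<noteq> 0" and le: "degree P \<le> degree Q" "degree P' \<le> degree Q'" for P' Q'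
  proof -
    have lc: "poly.coeff (A * B) (n + degree B) = poly.coeff A n * lead_coeff B"
      if "degree A \<le> n" for A B :: "'a puiseux_hat poly" and n
    proof (cases "degree A = n")
      case True
      then show ?thesis using coeff_mult_degree_sum[of A B] by simp
    next
      case False
      then have "degree A < n" using that by simp
      moreover have "degree (A * B) \<le> degree A + degree B" by (rule degree_mult_le)
      ultimately show ?thesis by (simp add: coeff_eq_0)
    qed
    have "poly.coeff P (degree Q) * lead_coeff Q' = poly.coeff P' (degree Q') * lead_coeff Q"
      using lc[OF le(1), of Q'] lc[OF le(2), of Q] e(1) by (simp add: add.commute)
    then show ?thesis using Q e(2) by (simp add: field_simps)
  qed
  show ?thesis
  proof (cases "degree P \<le> degree Q")
    case True
    have "{ennreal (habs r (poly.coeff P' (degree Q') / lead_coeff Q')) | P' Q'.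
      Fraction_Field.Fract P Q = Fraction_Field.Fract P' Q' \<and> Q' \<noteq> 0 \<and> degree P' \<le> degree Q'}
      = {ennreal (habs r (poly.coeff P (degree Q) / lead_coeff Q))}"
    proof (intro equalityI subsetI)
      fix t assume "t \<in> {ennreal (habs r (poly.coeff P' (degree Q') / lead_coeff Q')) | P' Q'.
        Fraction_Field.Fract P Q = Fraction_Field.Fract P' Q' \<and> Q' \<noteq> 0 \<and> degree P' \<le> degree Q'}"
      then obtain P' Q' where t: "t = ennreal (habs r (poly.coeff P' (degree Q') / lead_coeff Q'))"
        "Fraction_Field.Fract P Q = Fraction_Field.Fract P' Q'" "Q' \<noteq> 0" "degree P' \<le> degree Q'"
        by blast
      have "P * Q' = P' * Q" using t(2,3) Q by (simp add: eq_fract)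
      from val[OF this t(3) True t(4)] t(1)
      show "t \<in> {ennreal (habs r (poly.coeff P (degree Q) / lead_coeff Q))}" by simp
    next
      fix t assume "t \<in> {ennreal (habs r (poly.coeff P (degree Q) / lead_coeff Q))}"
      then show "t \<in> {ennreal (habs r (poly.coeff P' (degree Q') / lead_coeff Q')) | P' Q'.
        Fraction_Field.Fract P Q = Fraction_Field.Fract P' Q' \<and> Q' \<noteq> 0 \<and> degree P' \<le> degree Q'}"
        using Q True by blast
    qed
    then show ?thesis using True unfolding berk_infinity_def by simp
  next
    case False
    then have P: "P \<noteq> 0" by auto
    have "{ennreal (habs r (poly.coeff P' (degree Q') / lead_coeff Q')) | P' Q'.
      Fraction_Field.Fract P Q = Fraction_Field.Fract P' Q' \<and> Q' \<noteq> 0 \<and> degree P' \<le> degree Q'} = {}"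
    proof (intro equals0I, clarify)
      fix P' Q' :: "'a puiseux_hat poly"
      assume "Fraction_Field.Fract P Q = Fraction_Field.Fract P' Q'" "Q' \<noteq> 0" "degree P' \<le> degree Q'"
      then show False using deg[of Q' P'] P Q False by (simp add: eq_fract)
    qed
    then show ?thesis using False unfolding berk_infinity_def by (simp only: Inf_empty if_False)
  qed
qed

section \<open>Multiplicities\<close>

definition ecard :: "'a set \<Rightarrow> enat"
  where "ecard A = (if finite A then enat (card A) else \<infinity>)"

text \<open>The left action on points, \<open>\<parallel>f\<parallel>\<^bsub>\<sigma>\<zeta>\<^esub> = \<parallel>\<sigma>\<^sup>-\<^sup>1 f\<parallel>\<^bsub>\<zeta>\<^esub>\<close>.\<close>

definition galois_point ::
  "('k::field puiseux_hat \<Rightarrow> 'k puiseux_hat) \<Rightarrow> ('k ratfun \<Rightarrow> ennreal) \<Rightarrow> 'k ratfun \<Rightarrow> ennreal"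
  where "galois_point \<sigma> \<zeta> = (\<lambda>f. \<zeta> (ratfun_map (inv \<sigma>) f))"

definition point_mult :: "real \<Rightarrow> ('k::field ratfun \<Rightarrow> ennreal) \<Rightarrow> enat"
  where "point_mult r \<zeta> = ecard ((\<lambda>\<sigma>. galois_point \<sigma> \<zeta>) ` galois r)"

text \<open>
  On positive extended naturals, \<open>dvd\<close> is the intended divisibility: everything divides \<open>\<infinity>\<close>,
  and \<open>\<infinity>\<close> divides only itself.
\<close>

definition points_dvd :: "real \<Rightarrow> enat \<Rightarrow> ('k::field ratfun \<Rightarrow> ennreal) set"
  where "points_dvd r m = {\<zeta> \<in> berk_line r. point_mult r \<zeta> dvd m}"

fun enat_lcm :: "enat \<Rightarrow> enat \<Rightarrow> enat"
  where "enat_lcm (enat a) (enat b) = enat (lcm a b)"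
  | "enat_lcm a b = \<infinity>"

section \<open>Puiseux skew products\<close>

definition compatible_roots :: "(nat \<Rightarrow> 'k::field) \<Rightarrow> bool"
  where "compatible_roots l \<longleftrightarrow> (\<forall>b>0. \<forall>c>0. l (b * c) ^ c = l b)"

definition power_series :: "'k::field fps \<Rightarrow> 'k puiseux_hat"
  where "power_series p = laurent 1 (fps_to_fls p)"

text \<open>
  A Puiseux skew endomorphism with \<open>\<phi>(x) = \<lambda> x\<^sup>n (1 + h(x))\<close>, in its action on rational
  functions over the completion. Here \<open>\<psi>\<close> is its restriction to the completion; finite sums of
  monomials being dense, \<open>\<psi>\<close> is determined by \<open>n\<close>, \<open>h\<close> and the chosen roots \<open>l b\<close> of
  \<open>\<lambda> = l 1\<close>, and \<open>\<phi>\<close> is determined by \<open>\<psi>\<close> and \<open>\<phi> rvar\<close>. The power \<open>(1 + h)\<^sup>a\<^sup>/\<^sup>b\<close> is the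
  composition of the binomial series with \<open>h\<close>.
\<close>

definition puiseux_skew_endo ::
  "real \<Rightarrow> nat \<Rightarrow> ('k::field_char_0 ratfun \<Rightarrow> 'k ratfun) \<Rightarrow> bool"
  where "puiseux_skew_endo r n \<phi> \<longleftrightarrow> n > 0 \<and> is_ring_hom \<phi> \<and> \<phi> ` puiseux_ratfun \<subseteq> puiseux_ratfun \<and>
    (\<exists>\<psi> l h. (\<forall>f. \<phi> (rconst f) = rconst (\<psi> f)) \<and>
      continuous_map (htopology r) (htopology r) \<psi> \<and>
      (\<forall>c. \<psi> (hsingle 0 c) = hsingle 0 c) \<and>
      compatible_roots l \<and> l 1 \<noteq> 0 \<and> fps_nth h 0 = 0 \<and>
      \<psi> (hsingle 1 1) = power_series (fps_const (l 1) * fps_X ^ n * (1 + h)) \<and>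
      (\<forall>a::int. \<forall>b>0. \<psi> (hsingle (of_int a / of_nat b) 1) =
        hsingle (of_nat n * (of_int a / of_nat b)) (l b powi a) *
        power_series (fps_compose (fps_binomial (of_int a / of_nat b)) h)))"

definition ennreal_root :: "nat \<Rightarrow> ennreal \<Rightarrow> ennreal"
  where "ennreal_root n t = (if t = top then top else ennreal (root n (enn2real t)))"

definition skew_product ::
  "nat \<Rightarrow> ('k::field ratfun \<Rightarrow> 'k ratfun) \<Rightarrow> ('k ratfun \<Rightarrow> ennreal) \<Rightarrow> 'k ratfun \<Rightarrow> ennreal"
  where "skew_product n \<phi> \<zeta> = (\<lambda>f. ennreal_root n (\<zeta> (\<phi> f)))"

definition skew_mult :: "real \<Rightarrow> ('k::field ratfun \<Rightarrow> 'k ratfun) \<Rightarrow> enat"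
  where "skew_mult r \<phi> = ecard ((\<lambda>\<sigma>. ratfun_map \<sigma> (\<phi> rvar)) ` galois r)"

end

theory Submission
  imports Defs "HOL-Library.Function_Algebras"
begin

text \<open>
  Since \<open>k\<close> is algebraically closed, a Galois element is a character \<open>\<omega>\<close> of the rational numbers
  that is trivial on the integers, acting by \<open>x\<^sup>q \<mapsto> \<omega>(q) x\<^sup>q\<close> (lemma \<open>galois_eq_twists\<close>). The Galois
  group is therefore abelian and divides well: a character that is trivial at \<open>1/N\<close> is an \<open>N\<close>-th
  power, namely of \<open>q \<mapsto> \<omega>(q/N)\<close>.

  A skew endomorphism \<open>\<phi>\<close> with scale factor \<open>1/n\<close> multiplies exponents by \<open>n\<close>, so \<open>\<omega> \<circ> \<phi> = \<phi> \<circ> \<omega>\<^sup>n\<close>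
  on series, and on all rational functions when \<open>\<omega>\<close> fixes \<open>\<phi>(y)\<close> (lemma \<open>skew_endo_twist\<close>). Hence if
  \<open>\<omega>\<close> fixes both \<open>\<phi>(y)\<close> and \<open>\<zeta>\<close>, then \<open>\<omega>\<^sup>n\<close> fixes the image of \<open>\<zeta>\<close>. Let \<open>L\<close> be the least common
  multiple of the two multiplicities, assumed finite; otherwise there is nothing to prove. In an
  abelian group acting with an orbit of size \<open>a\<close>, every \<open>a\<close>-th power fixes that orbit
  (\<open>homogeneous_power_card\<close>), so every \<open>L\<close>-th power fixes \<open>\<phi>(y)\<close> and \<open>\<zeta>\<close>. So every \<open>n L\<close>-th power,
  that is, every character trivial at \<open>1/(n L)\<close>, fixes the image of \<open>\<zeta>\<close>. The orbit of the image is
  then an orbit of the group of values at \<open>1/(n L)\<close>, a subgroup of the cyclic group of \<open>n L\<close>-th roots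
  of unity, and its size divides \<open>n L\<close> (\<open>galois_orbit_card_dvd\<close>).

  The inclusion of sets requires in addition that a skew product maps the Berkovich line to itself.
  For this the points are characterised by their values on all rational functions
  (\<open>berk_line_iff\<close>); the resulting conditions are inherited through \<open>\<phi>\<close> and through the \<open>n\<close>-th root,
  because \<open>\<phi>\<close> raises absolute values of constants to the \<open>n\<close>-th power (\<open>skew_endo_habs\<close>).
\<close>

section \<open>Homogeneous maps on abelian groups\<close>

text \<open>
  Orbits enter only through orbit maps \<open>g \<mapsto> g z\<close>. Up to a bijection of their images, these are
  exactly the maps for which translations of the group carry fibres into fibres. Working inside a commutative monoid lets the same lemmas serve for groups of characters and
  for groups of roots of unity.
\<close>

locale mult_subgroup =
  fixes G :: "'g::comm_monoid_mult set"
  assumes one_closed: "1 \<in> G"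
    and mult_closed: "x \<in> G \<Longrightarrow> y \<in> G \<Longrightarrow> x * y \<in> G"
    and ex_inverse: "x \<in> G \<Longrightarrow> \<exists>y\<in>G. x * y = 1"
begin

definition homogeneous :: "('g \<Rightarrow> 'z) \<Rightarrow> bool"
  where "homogeneous F \<longleftrightarrow> (\<forall>x\<in>G. \<forall>y\<in>G. \<forall>z\<in>G. F x = F y \<longrightarrow> F (z * x) = F (z * y))"

lemma homogeneousD:
  "homogeneous F \<Longrightarrow> x \<in> G \<Longrightarrow> y \<in> G \<Longrightarrow> z \<in> G \<Longrightarrow> F x = F y \<Longrightarrow> F (z * x) = F (z * y)"
  unfolding homogeneous_def by blast

lemma homogeneous_cancel:
  assumes F: "homogeneous F" and x: "x \<in> G" "y \<in> G" "z \<in> G" and eq: "F (z * x) = F (z * y)"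
  shows "F x = F y"
proof -
  obtain w where w: "w \<in> G" "z * w = 1" using ex_inverse[OF x(3)] by blast
  have "F (w * (z * x)) = F (w * (z * y))"
    using homogeneousD[OF F _ _ w(1) eq] x mult_closed by blast
  moreover have "w * (z * u) = u" for u
    using w(2) by (simp add: mult.assoc[symmetric] mult.commute[of w z])
  ultimately show ?thesis by simp
qed

lemma power_closed: "x \<in> G \<Longrightarrow> x ^ i \<in> G"
  by (induction i) (auto intro: one_closed mult_closed)

lemma prod_closed: "(\<And>i. i \<in> I \<Longrightarrow> f i \<in> G) \<Longrightarrow> prod f I \<in> G"
  by (induction I rule: infinite_finite_induct) (auto intro: one_closed mult_closed)

lemma homogeneous_prod:
  assumes F: "homogeneous F" and fg: "\<And>i. i \<in> I \<Longrightarrow> f i \<in> G \<and> g i \<in> G \<and> F (f i) = F (g i)"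
  shows "F (prod f I) = F (prod g I)"
  using fg
proof (induction I rule: infinite_finite_induct)
  case (insert i I)
  have c: "prod f I \<in> G" "prod g I \<in> G" "f i \<in> G" "g i \<in> G"
    using insert.prems prod_closed[of I] by auto
  have "F (f i * prod f I) = F (f i * prod g I)"
    using homogeneousD[OF F c(1,2,3)] insert by blast
  also have "\<dots> = F (prod g I * g i)"
    using homogeneousD[OF F c(3,4,2)] insert.prems by (simp add: mult.commute)
  finally show ?case using insert by (simp add: mult.commute)
qed auto

text \<open>
  The analogue of \<open>x ^ card G = 1\<close>, with the classical proof for abelian groups: multiplication
  by \<open>x\<close> permutes the fibres, so the product \<open>P\<close> of a system of representatives and
  \<open>x ^ card (F ` G) * P\<close> lie in the same fibre.
\<close>

lemma homogeneous_power_card: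
  assumes F: "homogeneous F" and fin: "finite (F ` G)" and x: "x \<in> G"
  shows "F (x ^ card (F ` G)) = F 1"
proof -
  define c where "c u = (SOME g. g \<in> G \<and> F g = u)" for u
  have c: "c u \<in> G" "F (c u) = u" if "u \<in> F ` G" for u
    using someI_ex[of "\<lambda>g. g \<in> G \<and> F g = u"] that unfolding c_def by blast+
  define s where "s u = F (x * c u)" for u
  have s: "s u \<in> F ` G" if "u \<in> F ` G" for u
    using c[OF that] x mult_closed unfolding s_def by blast
  have "inj_on s (F ` G)"
  proof (rule inj_onI)
    fix u v assume uv: "u \<in> F ` G" "v \<in> F ` G" "s u = s v"
    have "F (c u) = F (c v)"
      by (rule homogeneous_cancel[OF F _ _ x]) (use uv c s_def in auto)
    then show "u = v" using c uv by auto
  qed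
  then have bij: "bij_betw s (F ` G) (F ` G)"
    using s endo_inj_surj[OF fin, of s] by (auto simp: bij_betw_def)
  define P where "P = (\<Prod>u\<in>F ` G. c u)"
  have P: "P \<in> G" unfolding P_def by (rule prod_closed) (rule c)
  have "F (\<Prod>u\<in>F ` G. x * c u) = F (\<Prod>u\<in>F ` G. c (s u))"
  proof (rule homogeneous_prod[OF F])
    fix u assume u: "u \<in> F ` G"
    show "x * c u \<in> G \<and> c (s u) \<in> G \<and> F (x * c u) = F (c (s u))"
      using c[OF u] c[OF s[OF u]] x mult_closed by (auto simp: s_def)
  qed
  also have "(\<Prod>u\<in>F ` G. c (s u)) = P"
    unfolding P_def by (rule prod.reindex_bij_betw[OF bij])
  also have "(\<Prod>u\<in>F ` G. x * c u) = P * x ^ card (F ` G)"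
    by (simp add: prod.distrib P_def mult.commute)
  finally have "F (P * x ^ card (F ` G)) = F (P * 1)" by simp
  then show ?thesis
    by (rule homogeneous_cancel[OF F power_closed[OF x] one_closed P])
qed

text \<open>
  Lagrange's theorem for a map \<open>F\<close> that factors through \<open>H\<close>: the fibres of the induced map from
  \<open>H ` G\<close> onto \<open>F ` G\<close> are translates of one another.
\<close>

lemma card_homogeneous_image:
  assumes F: "homogeneous F" and H: "homogeneous H" and fin: "finite (H ` G)"
    and le: "\<And>x. x \<in> G \<Longrightarrow> H x = H 1 \<Longrightarrow> F x = F 1"
  shows "finite (F ` G)"
    and "card (H ` G) = card (F ` G) * card (H ` {x \<in> G. F x = F 1})"
proof -
  have fac: "F x = F y" if xy: "x \<in> G" "y \<in> G" "H x = H y" for x y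
  proof -
    obtain w where w: "w \<in> G" "y * w = 1" using ex_inverse[OF xy(2)] by blast
    have "H (w * x) = H (w * y)" using homogeneousD[OF H xy(1,2) w(1) xy(3)] .
    also have "w * y = 1" using w(2) by (simp add: mult.commute)
    finally have "F (w * x) = F 1" using le w(1) xy(1) mult_closed by blast
    then have "F (w * x) = F (w * y)" using w(2) by (simp add: mult.commute)
    then show ?thesis by (rule homogeneous_cancel[OF F xy(1,2) w(1)])
  qed
  \<comment> \<open>the induced map from the image of \<open>H\<close> onto that of \<open>F\<close>\<close>
  define p where "p u = F (SOME g. g \<in> G \<and> H g = u)" for u
  have p: "p (H x) = F x" if x: "x \<in> G" for x
  proof -
    have "(SOME g. g \<in> G \<and> H g = H x) \<in> G \<and> H (SOME g. g \<in> G \<and> H g = H x) = H x"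
      by (rule someI[of _ x]) (use x in simp)
    then show ?thesis using fac x unfolding p_def by blast
  qed
  have img: "F ` G = p ` H ` G" using p by force
  show finF: "finite (F ` G)" unfolding img using fin by (rule finite_imageI)
  let ?S = "{x \<in> G. F x = F 1}"
  have fib: "card (H ` {y \<in> G. F y = F x}) = card (H ` ?S)" if x: "x \<in> G" for x
  proof -
    \<comment> \<open>translation by \<open>x\<close> on the image of \<open>H\<close>, carrying the fibre over \<open>F 1\<close> to the one over \<open>F x\<close>\<close>
    define t where "t u = H (x * (SOME g. g \<in> G \<and> H g = u))" for u
    have t: "t (H g) = H (x * g)" if g: "g \<in> G" for g
    proof -
      have "(SOME g'. g' \<in> G \<and> H g' = H g) \<in> G \<and> H (SOME g'. g' \<in> G \<and> H g' = H g) = H g"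
        by (rule someI[of _ g]) (use g in simp)
      then show ?thesis unfolding t_def using homogeneousD[OF H _ g x] by blast
    qed
    have "inj_on t (H ` ?S)"
    proof (rule inj_onI)
      fix u v assume "u \<in> H ` ?S" "v \<in> H ` ?S" "t u = t v"
      then obtain a b where ab: "a \<in> G" "b \<in> G" "u = H a" "v = H b" "H (x * a) = H (x * b)"
        using t by auto
      show "u = v" unfolding ab(3,4) by (rule homogeneous_cancel[OF H ab(1,2) x ab(5)])
    qed
    moreover have "t ` H ` ?S = H ` {y \<in> G. F y = F x}"
    proof (intro equalityI subsetI)
      fix u assume "u \<in> t ` H ` ?S"
      then obtain a where a: "a \<in> G" "F a = F 1" "u = H (x * a)" using t by auto
      have "F (x * a) = F (x * 1)" by (rule homogeneousD[OF F a(1) one_closed x a(2)])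
      then show "u \<in> H ` {y \<in> G. F y = F x}" using a x mult_closed by auto
    next
      fix u assume "u \<in> H ` {y \<in> G. F y = F x}"
      then obtain y where y: "y \<in> G" "F y = F x" "u = H y" by auto
      obtain w where w: "w \<in> G" "x * w = 1" using ex_inverse[OF x] by blast
      have "F (w * y) = F (w * x)" by (rule homogeneousD[OF F y(1) x w(1) y(2)])
      then have "w * y \<in> ?S" using w y mult_closed by (simp add: mult.commute[of w x])
      moreover have "x * (w * y) = y" using w(2) by (simp add: mult.assoc[symmetric])
      then have "u = t (H (w * y))" using t[of "w * y"] w y mult_closed by simp
      ultimately show "u \<in> t ` H ` ?S" by (intro image_eqI[of u t "H (w * y)"] imageI)
    qed
    ultimately show ?thesis using card_image[of t "H ` ?S"] by simp
  qed
  have "H ` G = (\<Union>v\<in>F ` G. H ` {y \<in> G. F y = v})" by auto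
  also have "card \<dots> = (\<Sum>v\<in>F ` G. card (H ` {y \<in> G. F y = v}))"
  proof (rule card_UN_disjoint[OF finF])
    show "\<forall>v\<in>F ` G. finite (H ` {y \<in> G. F y = v})"
      using finite_subset[OF image_mono fin] by simp
    show "\<forall>v\<in>F ` G. \<forall>w\<in>F ` G. v \<noteq> w \<longrightarrow>
      H ` {y \<in> G. F y = v} \<inter> H ` {y \<in> G. F y = w} = {}"
    proof (intro ballI impI equals0I)
      fix v w u assume vw: "v \<noteq> w"
        and "u \<in> H ` {y \<in> G. F y = v} \<inter> H ` {y \<in> G. F y = w}"
      then obtain a b where "a \<in> G" "b \<in> G" "H a = H b" "F a = v" "F b = w" by auto
      then show False using fac[of a b] vw by simp
    qed
  qed
  also have "\<dots> = (\<Sum>v\<in>F ` G. card (H ` ?S))" by (rule sum.cong) (use fib in auto)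
  finally show "card (H ` G) = card (F ` G) * card (H ` ?S)" by simp
qed

text \<open>The preceding count for the map \<open>x \<mapsto> x I\<close> to cosets, whose fibre over \<open>I\<close> is \<open>I\<close> itself.\<close>

lemma card_subgroup_dvd:
  assumes sub: "mult_subgroup I" "I \<subseteq> G" and fin: "finite G"
  shows "card I dvd card G"
proof -
  interpret I: mult_subgroup I by (rule sub)
  define F where "F x = (\<lambda>y. x * y) ` I" for x
  have F: "homogeneous F"
    unfolding homogeneous_def
  proof (intro ballI impI)
    fix x y z assume "F x = F y"
    then have "(\<lambda>u. z * u) ` F x = (\<lambda>u. z * u) ` F y" by simp
    then show "F (z * x) = F (z * y)" by (simp add: F_def image_image mult.assoc)
  qed
  have S: "{x \<in> G. F x = F 1} = I"
  proof (intro equalityI subsetI)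
    fix x assume x: "x \<in> {x \<in> G. F x = F 1}"
    then have "x * 1 \<in> F 1" using I.one_closed unfolding F_def by blast
    then show "x \<in> I" by (simp add: F_def)
  next
    fix x assume x: "x \<in> I"
    have "u \<in> F x" if u: "u \<in> I" for u
    proof -
      obtain w where w: "w \<in> I" "x * w = 1" using I.ex_inverse[OF x] by blast
      have "u = x * (w * u)" using w by (simp add: mult.assoc[symmetric])
      then show ?thesis using w u I.mult_closed unfolding F_def by blast
    qed
    moreover have "u \<in> I" if "u \<in> F x" for u using that x I.mult_closed by (auto simp: F_def)
    ultimately have "F x = I" by blast
    then show "x \<in> {x \<in> G. F x = F 1}" using x sub(2) by (auto simp: F_def)
  qed
  have "card (id ` G) = card (F ` G) * card (id ` {x \<in> G. F x = F 1})"
    by (rule card_homogeneous_image[OF F]) (use fin in \<open>auto simp: homogeneous_def\<close>)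
  then show ?thesis by (simp add: S)
qed

end

section \<open>Roots of unity\<close>

text \<open>In characteristic \<open>0\<close> the polynomial \<open>X\<^sup>N - 1\<close> has no common root with \<open>N X\<^sup>N\<^sup>-\<^sup>1\<close>, its derivative.\<close>

lemma card_roots_of_unity:
  assumes N: "N > 0"
  shows "card {z :: 'k::{alg_closed_field, field_char_0}. z ^ N = 1} = N"
proof -
  define p :: "'k poly" where "p = monom 1 N - 1"
  have dp: "degree p = N" and p0: "p \<noteq> 0"
  proof -
    have m: "degree (monom (1 :: 'k) N) = N" by (rule degree_monom_eq) (rule one_neq_zero)
    have "degree (- 1 :: 'k poly) < degree (monom (1 :: 'k) N)"
      unfolding m degree_minus degree_1 using N .
    then show "degree p = N" unfolding p_def diff_conv_add_uminus by (metis degree_add_eq_left m)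
    then show "p \<noteq> 0" using N by (metis degree_0 less_irrefl)
  qed
  have roots: "{z. poly p z = 0} = {z. z ^ N = 1}" by (simp add: p_def poly_monom)
  have rs: "rsquarefree p"
    unfolding rsquarefree_roots
  proof (intro allI notI)
    fix a assume a: "poly p a = 0 \<and> poly (pderiv p) a = 0"
    have "of_nat N * a ^ (N - 1) = 0"
      using a by (simp add: p_def pderiv_diff pderiv_monom poly_monom)
    then have "a = 0" using N by (cases "N - 1") auto
    then show False using a N by (simp add: p_def poly_monom power_0_left)
  qed
  obtain A where A: "size A = degree p" "p = smult (lead_coeff p) (\<Prod>x\<in>#A. [:-x, 1:])"
    using alg_closed_imp_factorization[OF p0] by blast
  have cnt: "count A x \<le> 1" for x
  proof (rule ccontr)
    assume c: "\<not> count A x \<le> 1"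
    then have "x \<in># A" by (metis count_eq_zero_iff le_numeral_extra(3) zero_le_one)
    then obtain A' where A': "A = add_mset x A'" by (metis multi_member_split)
    then have "x \<in># A'" using c by (auto simp: not_in_iff)
    then obtain B where "A' = add_mset x B" by (metis multi_member_split)
    then have B: "A = add_mset x (add_mset x B)" using A' by simp
    have "p = [:-x, 1:] ^ 2 * smult (lead_coeff p) (\<Prod>x\<in>#B. [:-x, 1:])"
      by (subst A(2)) (simp only: B image_mset_add_mset prod_mset.add_mset power2_eq_square
          mult_smult_right mult.assoc)
    then have "[:-x, 1:] ^ 2 dvd p" by (rule dvdI)
    then have "2 \<le> order x p" using p0 by (simp add: order_divides)
    then show False using rs p0 by (auto simp: rsquarefree_def dest: spec[of _ x])
  qed
  have "{z. poly p z = 0} = set_mset A"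
  proof -
    have "poly p z = 0 \<longleftrightarrow> z \<in># A" for z
      by (subst A(2)) (use p0 in \<open>auto simp: poly_prod_mset prod_mset_zero_iff\<close>)
    then show ?thesis by auto
  qed
  moreover have "card (set_mset A) = size A"
  proof -
    have "count A x = 1" if "x \<in># A" for x using that cnt[of x] by (simp add: order_antisym Suc_le_eq)
    then show ?thesis by (simp add: size_multiset_overloaded_eq)
  qed
  ultimately show ?thesis using A(1) dp roots by simp
qed

section \<open>Additive maps on the completed Puiseux field\<close>

lift_definition truncation :: "rat \<Rightarrow> 'k::zero puiseux_hat \<Rightarrow> 'k puiseux_hat"
  is "\<lambda>B f q. if q \<le> B then f q else 0"
proof -
  fix B C and f :: "rat \<Rightarrow> 'k"
  assume "\<And>B. finite {q. q \<le> B \<and> f q \<noteq> 0}"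
  then show "finite {q. q \<le> C \<and> (if q \<le> B then f q else 0) \<noteq> 0}"
    by (rule rev_finite_subset) (auto split: if_splits)
qed

lemma hcoeff_truncation: "hcoeff (truncation B f) q = (if q \<le> B then hcoeff f q else 0)"
  by transfer simp

lemma truncation_eq_sum:
  "truncation B f = (\<Sum>q | q \<le> B \<and> hcoeff f q \<noteq> 0. hsingle q (hcoeff f q))"
  for f :: "'k::ab_group_add puiseux_hat"
  by (rule hat_eqI) (auto simp: hcoeff_truncation hcoeff_sum hcoeff_single sum.delta' finite_below)

lemma ring_hom_zero: "is_ring_hom F \<Longrightarrow> F 0 = 0"
  unfolding is_ring_hom_def by (metis add_cancel_right_right)

lemma ring_hom_one: "is_ring_hom F \<Longrightarrow> F 1 = 1"
  and ring_hom_add: "is_ring_hom F \<Longrightarrow> F (a + b) = F a + F b"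
  and ring_hom_mult: "is_ring_hom F \<Longrightarrow> F (a * b) = F a * F b"
  unfolding is_ring_hom_def by blast+

lemma ring_hom_uminus:
  assumes F: "is_ring_hom F"
  shows "F (- a) = - F a"
proof -
  have "F (- a) + F a = 0" using ring_hom_add[OF F, of "- a" a] ring_hom_zero[OF F] by simp
  then show ?thesis by (simp add: eq_neg_iff_add_eq_0)
qed

lemma ring_hom_sum: "is_ring_hom F \<Longrightarrow> F (sum f A) = (\<Sum>a\<in>A. F (f a))"
  by (induction A rule: infinite_finite_induct) (auto simp: ring_hom_zero ring_hom_add)

lemma ring_hom_power: "is_ring_hom F \<Longrightarrow> F (a ^ n) = F a ^ n"
  by (induction n) (auto simp: ring_hom_one ring_hom_mult)

lemma ring_hom_nonzero:
  fixes F :: "'a::field \<Rightarrow> 'b::comm_ring_1"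
  assumes F: "is_ring_hom F" and a: "a \<noteq> 0"
  shows "F a \<noteq> 0"
proof
  assume "F a = 0"
  then have "F (a * inverse a) = 0" by (simp add: ring_hom_mult[OF F])
  then show False using a by (simp add: ring_hom_one[OF F])
qed

lemma ring_hom_inverse:
  fixes F :: "'a::field \<Rightarrow> 'b::field"
  assumes F: "is_ring_hom F"
  shows "F (inverse a) = inverse (F a)"
proof (cases "a = 0")
  case False
  have "F (inverse a) * F a = 1"
    using ring_hom_mult[OF F, of "inverse a" a] ring_hom_one[OF F] False by simp
  then show ?thesis by (metis inverse_unique mult.commute)
qed (simp add: ring_hom_zero[OF F])

lemma ring_hom_divide:
  fixes F :: "'a::field \<Rightarrow> 'b::field"
  shows "is_ring_hom F \<Longrightarrow> F (a / b) = F a / F b"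
  by (simp add: divide_inverse ring_hom_mult ring_hom_inverse)

text \<open>For additive maps, continuity at \<open>0\<close> in the \<open>x\<close>-adic topology, in terms of coefficients.\<close>

definition adically_continuous :: "('k::zero puiseux_hat \<Rightarrow> 'k puiseux_hat) \<Rightarrow> bool"
  where "adically_continuous F \<longleftrightarrow>
    (\<forall>B. \<exists>C. \<forall>f. (\<forall>q\<le>C. hcoeff f q = 0) \<longrightarrow> (\<forall>q\<le>B. hcoeff (F f) q = 0))"

lemma adically_continuousE:
  assumes "adically_continuous F"
  obtains C where "C \<ge> D" "\<And>f q. (\<And>p. p \<le> C \<Longrightarrow> hcoeff f p = 0) \<Longrightarrow> q \<le> B \<Longrightarrow> hcoeff (F f) q = 0"
proof -
  obtain C where C: "\<And>f q. (\<forall>p\<le>C. hcoeff f p = 0) \<Longrightarrow> q \<le> B \<Longrightarrow> hcoeff (F f) q = 0"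
    using assms unfolding adically_continuous_def by metis
  have "hcoeff (F f) q = 0" if "\<And>p. p \<le> max C D \<Longrightarrow> hcoeff f p = 0" "q \<le> B" for f q
    using C[of f q] that by simp
  then show ?thesis using that[of "max C D"] by simp
qed

lemma adically_continuous_comp:
  assumes F: "adically_continuous F" and H: "adically_continuous H"
  shows "adically_continuous (\<lambda>f. F (H f))"
  unfolding adically_continuous_def
proof
  fix B
  obtain C where C: "\<And>f q. (\<And>p. p \<le> C \<Longrightarrow> hcoeff f p = 0) \<Longrightarrow> q \<le> B \<Longrightarrow> hcoeff (F f) q = 0"
    using adically_continuousE[OF F, of 0 B] by metis
  obtain D where D: "\<And>f q. (\<And>p. p \<le> D \<Longrightarrow> hcoeff f p = 0) \<Longrightarrow> q \<le> C \<Longrightarrow> hcoeff (H f) q = 0"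
    using adically_continuousE[OF H, of 0 C] by metis
  show "\<exists>D. \<forall>f. (\<forall>q\<le>D. hcoeff f q = 0) \<longrightarrow> (\<forall>q\<le>B. hcoeff (F (H f)) q = 0)"
    by (intro exI[of _ D] allI impI C D) auto
qed

lemma adically_continuous_isometry:
  assumes r: "0 < r" "r < 1" and F: "\<And>f. habs r (F f) = habs r f"
  shows "adically_continuous F"
  unfolding adically_continuous_def
proof
  fix B
  show "\<exists>C. \<forall>f. (\<forall>q\<le>C. hcoeff f q = 0) \<longrightarrow> (\<forall>q\<le>B. hcoeff (F f) q = 0)"
    unfolding habs_less_iff[OF r, symmetric] F by blast
qed

lemma adically_continuous_if_continuous_map:
  fixes F :: "'k::field puiseux_hat \<Rightarrow> 'k puiseux_hat"
  assumes r: "0 < r" "r < 1" and F: "continuous_map (htopology r) (htopology r) F" "F 0 = 0"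
  shows "adically_continuous F"
  unfolding adically_continuous_def
proof
  fix B :: rat
  interpret M: Metric_space UNIV "hdist r :: 'k puiseux_hat \<Rightarrow> _" by (rule metric_space_hdist[OF r])
  have hd: "hdist r 0 f = habs r f" for f :: "'k puiseux_hat"
    by (metis M.commute hdist_def diff_zero)
  have "openin M.mtopology {f. F f \<in> M.mball 0 (r powr real_of_rat B)}"
    using openin_continuous_map_preimage[OF F(1) M.openin_mball] by simp
  moreover have "0 \<in> {f. F f \<in> M.mball 0 (r powr real_of_rat B)}"
    using F(2) r by simp
  ultimately obtain e where e: "e > 0" "M.mball 0 e \<subseteq> {f. F f \<in> M.mball 0 (r powr real_of_rat B)}"
    unfolding M.openin_mtopology by blast
  obtain C :: nat where C: "r powr real_of_rat (of_nat C) < e" using ex_powr_less[OF r e(1)] by blast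
  show "\<exists>C. \<forall>f. (\<forall>q\<le>C. hcoeff f q = 0) \<longrightarrow> (\<forall>q\<le>B. hcoeff (F f) q = 0)"
  proof (intro exI[of _ "of_nat C"] allI impI)
    fix f :: "'k puiseux_hat" and q :: rat
    assume f: "\<forall>q\<le>of_nat C. hcoeff f q = 0" and q: "q \<le> B"
    have "habs r f < e" using f habs_less_iff[OF r, of f "of_nat C"] C by simp
    then have "f \<in> M.mball 0 e" by (simp add: hd)
    then have "habs r (F f) < r powr real_of_rat B" using e(2) hd by auto
    then show "hcoeff (F f) q = 0" using habs_less_iff[OF r] q by blast
  qed
qed

text \<open>Truncations are finite sums of monomials, and every series is a limit of its truncations.\<close>

lemma ring_hom_eqI_monomials:
  fixes F H :: "'k::field puiseux_hat \<Rightarrow> 'k puiseux_hat"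
  assumes F: "is_ring_hom F" "adically_continuous F" and H: "is_ring_hom H" "adically_continuous H"
    and eq: "\<And>q c. F (hsingle q c) = H (hsingle q c)"
  shows "F = H"
proof (rule ext, rule hat_eqI)
  fix f :: "'k puiseux_hat" and B
  obtain C where C: "\<And>f q. (\<And>p. p \<le> C \<Longrightarrow> hcoeff f p = 0) \<Longrightarrow> q \<le> B \<Longrightarrow> hcoeff (F f) q = 0"
    using adically_continuousE[OF F(2), of 0 B] by metis
  obtain D where D: "D \<ge> C" "\<And>f q. (\<And>p. p \<le> D \<Longrightarrow> hcoeff f p = 0) \<Longrightarrow> q \<le> B \<Longrightarrow> hcoeff (H f) q = 0"
    using adically_continuousE[OF H(2), of C B] by metis
  define g where "g = f - truncation D f"
  have g: "hcoeff g p = 0" if "p \<le> D" for p using that by (simp add: g_def hcoeff_truncation)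
  have f: "f = truncation D f + g" by (simp add: g_def)
  have "F (truncation D f) = H (truncation D f)"
    by (simp add: truncation_eq_sum ring_hom_sum F(1) H(1) eq)
  moreover have "hcoeff (F g) B = 0" by (rule C) (use g D(1) in auto)
  moreover have "hcoeff (H g) B = 0" by (rule D(2)) (use g in auto)
  moreover have "F f = F (truncation D f) + F g" "H f = H (truncation D f) + H g"
    using f F(1) H(1) by (metis ring_hom_add)+
  ultimately show "hcoeff (F f) B = hcoeff (H f) B" by simp
qed

section \<open>The Galois group as a group of characters\<close>

text \<open>
  A compatible system \<open>(\<omega>\<^sub>b)\<close> of roots of unity is the same thing as the character
  \<open>a/b \<mapsto> \<omega>\<^sub>b\<^sup>a\<close> of the additive group of rational numbers, trivial on the integers.
\<close>

definition galois_characters :: "(rat \<Rightarrow> 'k::field) set"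
  where "galois_characters = {\<omega>. \<omega> 1 = 1 \<and> (\<forall>p q. \<omega> (p + q) = \<omega> p * \<omega> q)}"

lift_definition twist :: "(rat \<Rightarrow> 'k::mult_zero) \<Rightarrow> 'k puiseux_hat \<Rightarrow> 'k puiseux_hat"
  is "\<lambda>\<omega> f q. \<omega> q * f q"
proof -
  fix \<omega> f :: "rat \<Rightarrow> 'k" and B
  assume "\<And>B. finite {q. q \<le> B \<and> f q \<noteq> 0}"
  then show "finite {q. q \<le> B \<and> \<omega> q * f q \<noteq> 0}" by (rule rev_finite_subset) auto
qed

lemma hcoeff_twist [simp]: "hcoeff (twist \<omega> f) q = \<omega> q * hcoeff f q"
  by transfer simp

lemma twist_single: "twist \<omega> (hsingle q c) = hsingle q (\<omega> q * c)"
  by (rule hat_eqI) (simp add: hcoeff_single)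

lemma twist_times: "twist (\<omega> * \<eta>) f = twist \<omega> (twist \<eta> f)" for \<omega> :: "rat \<Rightarrow> 'k::field"
  by (rule hat_eqI) (simp add: mult.assoc)

lemma twist_one: "twist 1 f = f" for f :: "'k::field puiseux_hat"
  by (rule hat_eqI) simp

lemma galois_charactersD:
  assumes "\<omega> \<in> galois_characters"
  shows "\<omega> 1 = 1" "\<omega> (p + q) = \<omega> p * \<omega> q" "\<omega> 0 = 1" "\<omega> q \<noteq> 0" "\<omega> (- q) = inverse (\<omega> q)"
    "\<omega> (of_nat n * q) = \<omega> q ^ n" "\<omega> (of_int j) = 1"
proof -
  show one: "\<omega> 1 = 1" and add: "\<omega> (p + q) = \<omega> p * \<omega> q" for p q
    using assms by (auto simp: galois_characters_def)
  show zero: "\<omega> 0 = 1" using add[of 0 1] one by simp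
  have m: "\<omega> q * \<omega> (- q) = 1" for q using add[of q "- q"] zero by simp
  show "\<omega> q \<noteq> 0" "\<omega> (- q) = inverse (\<omega> q)" for q
    using m[of q] by (auto simp: inverse_unique)
  show nat: "\<omega> (of_nat n * q) = \<omega> q ^ n" for n q
    by (induction n) (auto simp: zero add algebra_simps)
  have n1: "\<omega> (of_nat n) = 1" for n using nat[of n 1] one by simp
  show "\<omega> (of_int j) = 1"
  proof (cases "j \<ge> 0")
    case True
    then show ?thesis using n1[of "nat j"] by simp
  next
    case False
    then show ?thesis using n1[of "nat (- j)"] \<open>\<And>q. \<omega> (- q) = inverse (\<omega> q)\<close>[of "of_nat (nat (- j))"] by simp
  qed
qed

lemma power_fun: "(\<omega> ^ n) q = \<omega> q ^ n" for \<omega> :: "'a \<Rightarrow> 'b::monoid_mult"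
  by (induction n) auto

lemma galois_characters_one: "1 \<in> galois_characters"
  and galois_characters_times:
    "\<omega> \<in> galois_characters \<Longrightarrow> \<eta> \<in> galois_characters \<Longrightarrow> \<omega> * \<eta> \<in> galois_characters"
  by (auto simp: galois_characters_def)

lemma galois_characters_inverse:
  "\<omega> \<in> galois_characters \<Longrightarrow> (\<lambda>q. inverse (\<omega> q)) \<in> galois_characters"
  by (auto simp: galois_characters_def)

lemma times_inverse_character:
  assumes "\<omega> \<in> galois_characters"
  shows "\<omega> * (\<lambda>q. inverse (\<omega> q)) = 1"
  by (rule ext) (simp add: galois_charactersD[OF assms])

lemma ring_hom_twist:
  assumes \<omega>: "\<omega> \<in> galois_characters"
  shows "is_ring_hom (twist \<omega>)"
  unfolding is_ring_hom_def
proof (intro conjI allI)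
  show "twist \<omega> 1 = 1"
    unfolding one_puiseux_hat_def twist_single by (simp add: galois_charactersD[OF \<omega>])
  fix f g
  show "twist \<omega> (f + g) = twist \<omega> f + twist \<omega> g"
    by (rule hat_eqI) (simp add: distrib_left)
  show "twist \<omega> (f * g) = twist \<omega> f * twist \<omega> g"
  proof (rule hat_eqI)
    fix q
    have "\<omega> p * \<omega> (q - p) = \<omega> q" for p
      using galois_charactersD(2)[OF \<omega>, of p "q - p"] by simp
    then have e: "\<omega> q * (a * b) = \<omega> p * a * (\<omega> (q - p) * b)" for p a b
      by (metis mult.assoc mult.left_commute)
    show "hcoeff (twist \<omega> (f * g)) q = hcoeff (twist \<omega> f * twist \<omega> g) q"
      unfolding hcoeff_twist hcoeff_mult sum_distrib_left
      by (rule sum.cong) (use e in \<open>auto simp: galois_charactersD[OF \<omega>]\<close>)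
  qed
qed

lemma habs_twist:
  assumes "\<omega> \<in> galois_characters"
  shows "habs r (twist \<omega> f) = habs r f"
proof (cases "f = 0")
  case False
  then have "twist \<omega> f \<noteq> 0"
    using ring_hom_nonzero[OF ring_hom_twist[OF assms]] by blast
  moreover have "hval (twist \<omega> f) = hval f"
    by (rule hval_eqI) (use hval[OF False] galois_charactersD[OF assms] in auto)
  ultimately show ?thesis using False by (simp add: habs_def)
qed (simp add: ring_hom_zero ring_hom_twist[OF assms])

lemma twist_laurent:
  assumes "\<omega> \<in> galois_characters" "f \<in> range (laurent 1)"
  shows "twist \<omega> f = f"
proof (rule hat_eqI)
  fix q
  have "hcoeff f q = 0 \<or> q \<in> \<int>" using assms(2) range_laurent[of 1] by auto
  then show "hcoeff (twist \<omega> f) q = hcoeff f q"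
    by (auto elim!: Ints_cases simp: galois_charactersD[OF assms(1)])
qed

lemma twist_puiseux:
  fixes \<omega> :: "rat \<Rightarrow> 'k::field"
  assumes "f \<in> puiseux"
  shows "twist \<omega> f \<in> puiseux"
proof -
  obtain n where n: "n \<ge> 1" "f \<in> range (laurent n)" using assms unfolding puiseux_def by auto
  then have "\<forall>q. hcoeff f q \<noteq> 0 \<longrightarrow> of_nat n * q \<in> \<int>" using range_laurent[of n] by force
  then have "\<forall>q. hcoeff (twist \<omega> f) q \<noteq> 0 \<longrightarrow> of_nat n * q \<in> \<int>" by auto
  then have "twist \<omega> f \<in> range (laurent n)" using range_laurent[of n] n(1) by force
  then show ?thesis using n(1) unfolding puiseux_def by blast
qed

lemma twist_inverse_character:
  assumes \<omega>: "\<omega> \<in> galois_characters"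
  shows "twist \<omega> (twist (\<lambda>q. inverse (\<omega> q)) f) = f" "twist (\<lambda>q. inverse (\<omega> q)) (twist \<omega> f) = f"
  using times_inverse_character[OF \<omega>]
  by (metis twist_times twist_one) (metis twist_times twist_one mult.commute times_inverse_character[OF \<omega>])

lemma inv_twist:
  assumes \<omega>: "\<omega> \<in> galois_characters"
  shows "inv (twist \<omega>) = twist (\<lambda>q. inverse (\<omega> q))"
  by (rule inv_unique_comp) (auto simp: fun_eq_iff twist_inverse_character[OF \<omega>])

lemma twist_in_galois:
  assumes \<omega>: "\<omega> \<in> galois_characters"
  shows "twist \<omega> \<in> galois r"
  unfolding galois_def
proof (intro CollectI conjI ballI allI)
  show "bij (twist \<omega>)"
    by (rule o_bij[of "twist (\<lambda>q. inverse (\<omega> q))"]) (auto simp: fun_eq_iff twist_inverse_character[OF \<omega>])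
  show "twist \<omega> ` puiseux = puiseux"
  proof (intro equalityI subsetI)
    fix f :: "'a puiseux_hat" assume "f \<in> puiseux"
    then have "twist (\<lambda>q. inverse (\<omega> q)) f \<in> puiseux" by (rule twist_puiseux)
    then show "f \<in> twist \<omega> ` puiseux"
      using twist_inverse_character(1)[OF \<omega>, of f] by (metis imageI)
  qed (auto intro: twist_puiseux)
qed (use ring_hom_twist[OF \<omega>] twist_laurent[OF \<omega>] habs_twist[OF \<omega>] in auto)

lemma single_power: "hsingle q c ^ n = hsingle (of_nat n * q) (c ^ n)" for c :: "'k::comm_ring_1"
  by (induction n) (auto simp: one_puiseux_hat_def hsingle_mult algebra_simps)

text \<open>
  Over an algebraically closed \<open>k\<close> the polynomial \<open>X\<^sup>b - 1\<close> already has \<open>b\<close> roots in \<open>k\<close>, so it has no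
  others in the larger field.
\<close>

lemma root_of_unity_constant:
  fixes u :: "'k::{alg_closed_field, field_char_0} puiseux_hat"
  assumes b: "b > 0" and u: "u ^ b = 1"
  shows "\<exists>z. u = hsingle 0 z"
proof -
  define p :: "'k puiseux_hat poly" where "p = monom 1 b - 1"
  have m: "degree (monom (1 :: 'k puiseux_hat) b) = b" by (rule degree_monom_eq) (rule one_neq_zero)
  have "degree (- 1 :: 'k puiseux_hat poly) < degree (monom (1 :: 'k puiseux_hat) b)"
    unfolding m degree_minus degree_1 using b .
  then have dp: "degree p = b" unfolding p_def diff_conv_add_uminus by (metis degree_add_eq_left m)
  then have p0: "p \<noteq> 0" using b by (metis degree_0 less_irrefl)
  have roots: "{z. poly p z = 0} = {z. z ^ b = 1}" by (simp add: p_def poly_monom)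
  have inj: "inj_on (hsingle 0) {z :: 'k. z ^ b = 1}"
    by (rule inj_onI) (metis hcoeff_single)
  have "hsingle 0 ` {z :: 'k. z ^ b = 1} = {z. poly p z = 0}"
  proof (rule card_seteq)
    show "finite {z. poly p z = 0}" using p0 by (rule poly_roots_finite)
    show "hsingle 0 ` {z :: 'k. z ^ b = 1} \<subseteq> {z. poly p z = 0}"
      unfolding roots by (auto simp: single_power one_puiseux_hat_def)
    show "card {z. poly p z = 0} \<le> card (hsingle 0 ` {z :: 'k. z ^ b = 1})"
      using card_poly_roots_bound[OF p0] card_roots_of_unity[OF b, where 'k = 'k]
      by (simp add: card_image[OF inj] dp)
  qed
  then show ?thesis using u roots by blast
qed

lemma single_int_laurent: "hsingle (of_int j) c \<in> range (laurent 1)"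
  using range_laurent[of 1] by (auto simp: hcoeff_single split: if_splits)

text \<open>
  An automorphism \<open>\<sigma>\<close> multiplies \<open>x\<^sup>q\<close> by an element whose \<open>b\<close>-th power is \<open>1\<close>, where \<open>b\<close> is the
  denominator of \<open>q\<close>, because \<open>\<sigma>\<close> fixes the integral power \<open>(x\<^sup>q)\<^sup>b\<close>.
\<close>

lemma galois_eq_twists:
  assumes r: "0 < r" "r < 1"
  shows "galois r =
    twist ` (galois_characters :: (rat \<Rightarrow> 'k::{alg_closed_field, field_char_0}) set)"
proof (intro equalityI subsetI)
  fix \<sigma> :: "'k puiseux_hat \<Rightarrow> 'k puiseux_hat" assume "\<sigma> \<in> galois r"
  then have hom: "is_ring_hom \<sigma>" and iso: "\<And>f. habs r (\<sigma> f) = habs r f"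
    and fix1: "\<And>f. f \<in> range (laurent 1) \<Longrightarrow> \<sigma> f = f"
    unfolding galois_def by blast+
  have const: "\<sigma> (hsingle 0 c) = hsingle 0 c" for c
    using fix1[OF single_int_laurent[of 0 c]] by simp
  have "\<exists>z. \<sigma> (hsingle q 1) = hsingle q z" for q
  proof -
    obtain a b where ab: "b > 0" "q = of_int a / of_int b"
      by (metis Fract_of_int_quotient Rat_cases)
    define u where "u = \<sigma> (hsingle q 1) * hsingle (- q) 1"
    have q: "of_nat (nat b) * q = of_int a" using ab by simp
    have "u ^ nat b = \<sigma> (hsingle q 1 ^ nat b) * hsingle (- q) 1 ^ nat b"
      by (simp add: u_def power_mult_distrib ring_hom_power[OF hom])
    also have "\<dots> = hsingle (of_int a) 1 * hsingle (- of_int a) 1"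
      using fix1[OF single_int_laurent[of a 1]] q by (simp add: single_power)
    also have "\<dots> = 1" by (simp add: hsingle_mult one_puiseux_hat_def)
    finally obtain z where z: "u = hsingle 0 z" using root_of_unity_constant[of "nat b"] ab by auto
    have "u * hsingle q 1 = \<sigma> (hsingle q 1) * (hsingle (- q) 1 * hsingle q 1)"
      by (simp only: u_def mult.assoc)
    then have "u * hsingle q 1 = \<sigma> (hsingle q 1)"
      by (simp add: hsingle_mult flip: one_puiseux_hat_def)
    then have "\<sigma> (hsingle q 1) = hsingle q z" using z by (simp add: hsingle_mult)
    then show ?thesis by blast
  qed
  then obtain \<omega> where \<omega>: "\<And>q. \<sigma> (hsingle q 1) = hsingle q (\<omega> q)" by metis
  have inj: "hsingle q a = hsingle q b \<Longrightarrow> a = b" for q and a b :: 'k by (metis hcoeff_single)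
  have X: "\<omega> \<in> galois_characters"
    unfolding galois_characters_def
  proof (intro CollectI conjI allI)
    show "\<omega> 1 = 1"
      using fix1[OF single_int_laurent[of 1 1]] \<omega>[of 1] inj by (metis of_int_1)
    fix p q
    have "\<sigma> (hsingle (p + q) 1) = \<sigma> (hsingle p 1) * \<sigma> (hsingle q 1)"
      by (simp add: hsingle_mult flip: ring_hom_mult[OF hom])
    then show "\<omega> (p + q) = \<omega> p * \<omega> q" by (intro inj[of "p + q"]) (simp add: \<omega> hsingle_mult)
  qed
  \<comment> \<open>so far they agree on powers of \<open>x\<close>; constants are fixed by both\<close>
  have "\<sigma> = twist \<omega>"
  proof (rule ring_hom_eqI_monomials)
    show "is_ring_hom \<sigma>" "is_ring_hom (twist \<omega>)" by (rule hom, rule ring_hom_twist[OF X])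
    show "adically_continuous \<sigma>" "adically_continuous (twist \<omega>)"
      by (rule adically_continuous_isometry[OF r]; simp add: iso habs_twist[OF X])+
    fix q c
    have "\<sigma> (hsingle 0 c * hsingle q 1) = hsingle 0 c * hsingle q (\<omega> q)"
      by (simp only: ring_hom_mult[OF hom] const \<omega>)
    then show "\<sigma> (hsingle q c) = twist \<omega> (hsingle q c)"
      by (simp add: hsingle_mult twist_single mult.commute)
  qed
  then show "\<sigma> \<in> twist ` galois_characters" using X by blast
next
  fix \<sigma> :: "'k puiseux_hat \<Rightarrow> 'k puiseux_hat" assume "\<sigma> \<in> twist ` galois_characters"
  then show "\<sigma> \<in> galois r" using twist_in_galois by blast
qed

section \<open>Ring homomorphisms of rational functions\<close>

lemma ring_hom_comp: "is_ring_hom F \<Longrightarrow> is_ring_hom H \<Longrightarrow> is_ring_hom (\<lambda>f. F (H f))"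
  by (auto simp: is_ring_hom_def)

lemma ring_hom_rconst: "is_ring_hom (rconst :: 'k::field puiseux_hat \<Rightarrow> _)"
  by (auto simp: is_ring_hom_def rconst_def One_fract_def one_pCons mult.commute)

lemma rconst_inject: "rconst a = rconst b \<longleftrightarrow> a = b"
  by (simp add: rconst_def eq_fract)

lemma Fract_eq_divide:
  "Q \<noteq> 0 \<Longrightarrow> Fraction_Field.Fract P Q = Fraction_Field.Fract P 1 / Fraction_Field.Fract Q 1"
  by simp

lemma Fract_pCons:
  "Fraction_Field.Fract (pCons a P) 1 = rconst a + rvar * Fraction_Field.Fract P 1"
  by (simp add: rconst_def rvar_def)

lemma ratfun_ring_hom_eqI:
  fixes F H :: "'k::field ratfun \<Rightarrow> 'k ratfun"
  assumes F: "is_ring_hom F" and H: "is_ring_hom H"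
    and const: "\<And>c. F (rconst c) = H (rconst c)" and var: "F rvar = H rvar"
  shows "F = H"
proof
  fix f :: "'k ratfun"
  have poly: "F (Fraction_Field.Fract P 1) = H (Fraction_Field.Fract P 1)" for P
  proof (induction P)
    case 0
    show ?case using ring_hom_zero[OF F] ring_hom_zero[OF H] by (simp add: Zero_fract_def[symmetric])
  next
    case (pCons a P)
    then show ?case
      unfolding Fract_pCons by (simp only: ring_hom_add[OF F] ring_hom_mult[OF F] ring_hom_add[OF H]
          ring_hom_mult[OF H] const var)
  qed
  obtain P Q where f: "f = Fraction_Field.Fract P Q" "Q \<noteq> 0" by (cases f)
  show "F f = H f"
    unfolding f(1) Fract_eq_divide[OF f(2)] by (simp only: ring_hom_divide[OF F] ring_hom_divide[OF H] poly)
qed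

lemma ring_hom_map_poly:
  fixes \<sigma> :: "'a::comm_ring_1 \<Rightarrow> 'b::comm_ring_1"
  assumes \<sigma>: "is_ring_hom \<sigma>"
  shows "is_ring_hom (map_poly \<sigma>)"
  unfolding is_ring_hom_def
proof (intro conjI allI)
  note coeff = coeff_map_poly[of \<sigma>, OF ring_hom_zero[OF \<sigma>]]
  show "map_poly \<sigma> 1 = 1"
    by (rule poly_eqI) (simp add: coeff ring_hom_one[OF \<sigma>] ring_hom_zero[OF \<sigma>])
  fix P Q
  show "map_poly \<sigma> (P + Q) = map_poly \<sigma> P + map_poly \<sigma> Q"
    by (rule poly_eqI) (simp add: coeff ring_hom_add[OF \<sigma>])
  show "map_poly \<sigma> (P * Q) = map_poly \<sigma> P * map_poly \<sigma> Q"
    by (rule poly_eqI) (simp add: coeff coeff_mult ring_hom_sum[OF \<sigma>] ring_hom_mult[OF \<sigma>])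
qed

lemma map_poly_nonzero:
  fixes \<sigma> :: "'a::field \<Rightarrow> 'b::comm_ring_1"
  assumes \<sigma>: "is_ring_hom \<sigma>" and P: "P \<noteq> 0"
  shows "map_poly \<sigma> P \<noteq> 0"
proof
  assume "map_poly \<sigma> P = 0"
  then have "\<sigma> (lead_coeff P) = 0"
    by (metis coeff_map_poly[of \<sigma>, OF ring_hom_zero[OF \<sigma>]] coeff_0)
  then show False using ring_hom_nonzero[OF \<sigma>, of "lead_coeff P"] P by simp
qed

lemma ring_hom_ratfun_map:
  fixes \<sigma> :: "'k::field puiseux_hat \<Rightarrow> 'k puiseux_hat"
  assumes \<sigma>: "is_ring_hom \<sigma>"
  shows "is_ring_hom (ratfun_map \<sigma>)"
  unfolding is_ring_hom_def
proof (intro conjI allI)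
  note m = ring_hom_map_poly[OF \<sigma>]
  show "ratfun_map \<sigma> 1 = 1"
    by (simp add: One_fract_def ratfun_map_Fract[OF \<sigma>] ring_hom_one[OF m])
  fix f g :: "'k ratfun"
  obtain P Q where f: "f = Fraction_Field.Fract P Q" "Q \<noteq> 0" by (cases f)
  obtain P' Q' where g: "g = Fraction_Field.Fract P' Q'" "Q' \<noteq> 0" by (cases g)
  note nz = map_poly_nonzero[OF \<sigma> f(2)] map_poly_nonzero[OF \<sigma> g(2)]
  show "ratfun_map \<sigma> (f + g) = ratfun_map \<sigma> f + ratfun_map \<sigma> g"
    using f(2) g(2) nz by (simp add: f(1) g(1) ratfun_map_Fract[OF \<sigma>] ring_hom_add[OF m] ring_hom_mult[OF m])
  show "ratfun_map \<sigma> (f * g) = ratfun_map \<sigma> f * ratfun_map \<sigma> g"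
    using f(2) g(2) by (simp add: f(1) g(1) ratfun_map_Fract[OF \<sigma>] ring_hom_mult[OF m])
qed

lemma ratfun_map_rconst: "is_ring_hom \<sigma> \<Longrightarrow> ratfun_map \<sigma> (rconst c) = rconst (\<sigma> c)"
  by (simp add: rconst_def ratfun_map_Fract ring_hom_one[OF ring_hom_map_poly] ring_hom_zero
      map_poly_pCons)

lemma ratfun_map_rvar: "is_ring_hom \<sigma> \<Longrightarrow> ratfun_map \<sigma> rvar = rvar"
  by (simp add: rvar_def ratfun_map_Fract ring_hom_one[OF ring_hom_map_poly] ring_hom_one ring_hom_zero
      map_poly_pCons)

lemma ratfun_map_comp:
  assumes "is_ring_hom \<sigma>" "is_ring_hom \<tau>"
  shows "ratfun_map (\<lambda>c. \<sigma> (\<tau> c)) f = ratfun_map \<sigma> (ratfun_map \<tau> f)"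
proof -
  have "ratfun_map (\<lambda>c. \<sigma> (\<tau> c)) = (\<lambda>f. ratfun_map \<sigma> (ratfun_map \<tau> f))"
    by (rule ratfun_ring_hom_eqI)
      (use assms in \<open>simp_all add: ring_hom_ratfun_map ring_hom_comp ratfun_map_rconst ratfun_map_rvar\<close>)
  then show ?thesis by simp
qed

lemma ratfun_map_twist_times:
  assumes "\<omega> \<in> galois_characters" "\<eta> \<in> galois_characters"
  shows "ratfun_map (twist (\<omega> * \<eta>)) f = ratfun_map (twist \<omega>) (ratfun_map (twist \<eta>) f)"
proof -
  have "twist (\<omega> * \<eta>) = (\<lambda>f. twist \<omega> (twist \<eta> f))" by (rule ext) (rule twist_times)
  then show ?thesis using ratfun_map_comp assms ring_hom_twist by metis
qed

lemma ratfun_map_twist_one: "ratfun_map (twist 1) f = f" for f :: "'k::field ratfun"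
proof -
  have "ratfun_map (twist 1) = (\<lambda>f :: 'k ratfun. f)"
    by (rule ratfun_ring_hom_eqI)
      (simp_all add: ring_hom_ratfun_map ratfun_map_rconst ratfun_map_rvar twist_one
        ring_hom_twist galois_characters_one is_ring_hom_def[of "\<lambda>f. f"])
  then show ?thesis by simp
qed

section \<open>Galois orbits\<close>

lemma mult_subgroup_galois_characters: "mult_subgroup (galois_characters :: (rat \<Rightarrow> 'k::field) set)"
proof
  fix \<omega> :: "rat \<Rightarrow> 'k" assume \<omega>: "\<omega> \<in> galois_characters"
  then show "\<exists>\<eta>\<in>galois_characters. \<omega> * \<eta> = 1"
    by (intro bexI[of _ "\<lambda>q. inverse (\<omega> q)"] times_inverse_character galois_characters_inverse)
qed (auto intro: galois_characters_one galois_characters_times)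

lemma homogeneous_galois_point:
  "mult_subgroup.homogeneous galois_characters
     (\<lambda>\<omega> :: rat \<Rightarrow> 'k::field. galois_point (twist \<omega>) \<zeta>)"
  unfolding mult_subgroup.homogeneous_def[OF mult_subgroup_galois_characters]
proof (intro ballI impI)
  fix x y z :: "rat \<Rightarrow> 'k"
  assume X: "x \<in> galois_characters" "y \<in> galois_characters" "z \<in> galois_characters"
    and eq: "galois_point (twist x) \<zeta> = galois_point (twist y) \<zeta>"
  have g: "galois_point (twist (z * u)) \<zeta> f =
      galois_point (twist u) \<zeta> (ratfun_map (inv (twist z)) f)" if u: "u \<in> galois_characters" for u f
  proof -
    have "(\<lambda>q. inverse ((z * u) q)) = (\<lambda>q. inverse (u q)) * (\<lambda>q. inverse (z q))"
      by (rule ext) (simp add: mult.commute)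
    then show ?thesis
      using X(3) u by (simp add: galois_point_def inv_twist galois_characters_times
          ratfun_map_twist_times galois_characters_inverse)
  qed
  show "galois_point (twist (z * x)) \<zeta> = galois_point (twist (z * y)) \<zeta>"
    by (rule ext) (simp only: g[OF X(1)] g[OF X(2)] eq)
qed

lemma homogeneous_ratfun_map:
  "mult_subgroup.homogeneous galois_characters (\<lambda>\<omega> :: rat \<Rightarrow> 'k::field. ratfun_map (twist \<omega>) f)"
  unfolding mult_subgroup.homogeneous_def[OF mult_subgroup_galois_characters]
  by (simp add: ratfun_map_twist_times)

lemma galois_point_one: "galois_point (twist 1) \<zeta> = \<zeta>" for \<zeta> :: "'k::field ratfun \<Rightarrow> ennreal"
  by (rule ext)
    (simp add: galois_point_def inv_twist galois_characters_one ratfun_map_twist_one one_fun_def[symmetric])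

text \<open>
  The fibres of \<open>F\<close> are unions of cosets of the group of characters trivial at \<open>1/N\<close>, so their
  number divides the index of that group. That group is the kernel of the restriction to
  \<open>k((x\<^sup>1\<^sup>/\<^sup>N))\<close>, whose automorphisms over \<open>k((x))\<close> are given by \<open>N\<close>-th roots of unity.
\<close>

lemma galois_orbit_card_dvd:
  fixes F :: "(rat \<Rightarrow> 'k::{alg_closed_field, field_char_0}) \<Rightarrow> 'z"
  assumes F: "mult_subgroup.homogeneous galois_characters F" and N: "N > 0"
    and ker: "\<And>\<omega>. \<omega> \<in> galois_characters \<Longrightarrow> \<omega> (1 / of_nat N) = 1 \<Longrightarrow> F \<omega> = F 1"
  shows "finite (F ` galois_characters)" and "card (F ` galois_characters) dvd N"
proof -
  interpret X: mult_subgroup "galois_characters :: (rat \<Rightarrow> 'k) set"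
    by (rule mult_subgroup_galois_characters)
  \<comment> \<open>restriction to \<open>k((x\<^sup>1\<^sup>/\<^sup>N))\<close>, through which \<open>F\<close> factors\<close>
  let ?H = "\<lambda>\<omega> :: rat \<Rightarrow> 'k. \<omega> (1 / of_nat N)"
  let ?mu = "{z :: 'k. z ^ N = 1}"
  have H: "X.homogeneous ?H" by (simp add: X.homogeneous_def)
  have mu: "card ?mu = N" by (rule card_roots_of_unity[OF N])
  then have fin: "finite ?mu" using N card_ge_0_finite by metis
  have sub: "?H ` galois_characters \<subseteq> ?mu"
  proof clarify
    fix \<omega> :: "rat \<Rightarrow> 'k" assume \<omega>: "\<omega> \<in> galois_characters"
    show "\<omega> (1 / of_nat N) ^ N = 1"
      using N galois_charactersD(1)[OF \<omega>] galois_charactersD(6)[OF \<omega>, of N "1 / of_nat N"] by simp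
  qed
  have Hmu: "mult_subgroup ?mu"
  proof
    fix z :: 'k assume "z \<in> ?mu"
    moreover have "z \<noteq> 0" using calculation N by (auto simp: power_0_left)
    ultimately show "\<exists>w\<in>?mu. z * w = 1"
      by (intro bexI[of _ "inverse z"]) (auto simp: power_inverse)
  qed (auto simp: power_mult_distrib)
  have HX: "mult_subgroup (?H ` galois_characters)"
  proof
    show "1 \<in> ?H ` galois_characters" by (rule image_eqI[of _ _ 1]) (auto simp: galois_characters_one)
    fix z assume "z \<in> ?H ` galois_characters"
    then obtain \<omega> where \<omega>: "\<omega> \<in> galois_characters" "z = ?H \<omega>" by blast
    show "\<exists>w\<in>?H ` galois_characters. z * w = 1"
      using galois_characters_inverse[OF \<omega>(1)] galois_charactersD(4)[OF \<omega>(1)] \<omega>(2)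
      by (intro bexI[of _ "inverse z"]) auto
    fix w assume "w \<in> ?H ` galois_characters"
    then obtain \<eta> where \<eta>: "\<eta> \<in> galois_characters" "w = ?H \<eta>" by blast
    show "z * w \<in> ?H ` galois_characters"
      by (rule image_eqI[of _ _ "\<omega> * \<eta>"]) (use \<omega> \<eta> galois_characters_times in auto)
  qed
  have ker': "F \<omega> = F 1" if "\<omega> \<in> galois_characters" "?H \<omega> = ?H 1" for \<omega> using ker that by simp
  note card = X.card_homogeneous_image[OF F H finite_subset[OF sub fin] ker']
  show "finite (F ` galois_characters)" by (rule card(1))
  have "card (F ` galois_characters) dvd card (?H ` galois_characters)"
    by (rule dvdI[OF card(2)])
  also have "\<dots> dvd card ?mu" by (rule mult_subgroup.card_subgroup_dvd[OF Hmu HX sub fin])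
  finally show "card (F ` galois_characters) dvd N" by (simp only: mu)
qed

section \<open>Commutation of skew products with the Galois action\<close>

lemma hcoeff_power_series: "hcoeff (power_series p) q =
  (if q \<in> \<int> \<and> q \<ge> 0 then fps_nth p (nat \<lfloor>q\<rfloor>) else 0)"
  by (auto simp: power_series_def laurent.rep_eq elim!: Ints_cases)

text \<open>
  The formula for \<open>(1 + h)\<^sup>q\<close> is replaced by an unspecified power series \<open>u q\<close>: the Galois action
  fixes every power series in \<open>x\<close>, and the constant coefficient \<open>1\<close> determines the valuation.
\<close>

lemma puiseux_skew_endoE:
  fixes \<phi> :: "'k::field_char_0 ratfun \<Rightarrow> 'k ratfun"
  assumes r: "0 < r" "r < 1" and \<phi>: "puiseux_skew_endo r n \<phi>"
  obtains \<psi> c u where "\<And>f. \<phi> (rconst f) = rconst (\<psi> f)" "is_ring_hom \<psi>" "adically_continuous \<psi>"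
    "\<And>q a. \<psi> (hsingle q a) = hsingle (of_nat n * q) (a * c q) * power_series (u q)"
    "\<And>q. c q \<noteq> 0" "\<And>q. fps_nth (u q) 0 = 1"
proof -
  obtain \<psi> l h where \<psi>: "\<And>f. \<phi> (rconst f) = rconst (\<psi> f)"
    "continuous_map (htopology r) (htopology r) \<psi>" "\<And>c. \<psi> (hsingle 0 c) = hsingle 0 c"
    and l: "compatible_roots l" "l 1 \<noteq> 0" and h: "fps_nth h 0 = 0"
    and mono: "\<And>(a::int) b. b > 0 \<Longrightarrow> \<psi> (hsingle (of_int a / of_nat b) 1) =
        hsingle (of_nat n * (of_int a / of_nat b)) (l b powi a) *
        power_series (fps_compose (fps_binomial (of_int a / of_nat b)) h)"
    using \<phi> unfolding puiseux_skew_endo_def by blast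
  have \<phi>hom: "is_ring_hom \<phi>" using \<phi> unfolding puiseux_skew_endo_def by blast
  have inj: "a = b" if "rconst a = rconst b" for a b :: "'k puiseux_hat" using that rconst_inject by blast
  note rc = ring_hom_one[OF ring_hom_rconst] ring_hom_add[OF ring_hom_rconst] ring_hom_mult[OF ring_hom_rconst]
  have hom: "is_ring_hom \<psi>"
    unfolding is_ring_hom_def
    by (intro conjI allI; rule inj; simp only: \<psi>(1)[symmetric] rc ring_hom_one[OF \<phi>hom]
        ring_hom_add[OF \<phi>hom] ring_hom_mult[OF \<phi>hom])
  have cont: "adically_continuous \<psi>"
    by (rule adically_continuous_if_continuous_map[OF r \<psi>(2) ring_hom_zero[OF hom]])
  have l0: "l b \<noteq> 0" if b: "b > 0" for b
  proof
    assume "l b = 0"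
    moreover have "l (1 * b) ^ b = l 1"
      using l(1)[unfolded compatible_roots_def, rule_format, OF zero_less_one b] .
    ultimately show False using l(2) b by (simp add: power_0_left)
  qed
  have "\<exists>c u. c \<noteq> 0 \<and> fps_nth u 0 = 1 \<and>
      (\<forall>a. \<psi> (hsingle q a) = hsingle (of_nat n * q) (a * c) * power_series u)" for q
  proof -
    obtain a b where ab: "b > 0" "q = of_int a / of_int b"
      by (metis Fract_of_int_quotient Rat_cases)
    then have q: "nat b > 0" "q = of_int a / of_nat (nat b)" by auto
    let ?u = "fps_compose (fps_binomial (of_int a / of_nat (nat b))) h"
    have "\<psi> (hsingle q d) = hsingle (of_nat n * q) (d * l (nat b) powi a) * power_series ?u" for d
    proof -
      have "\<psi> (hsingle q d) = \<psi> (hsingle 0 d) * \<psi> (hsingle q 1)"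
        by (simp add: hsingle_mult flip: ring_hom_mult[OF hom])
      also have "\<dots> = hsingle 0 d * hsingle (of_nat n * q) (l (nat b) powi a) * power_series ?u"
        unfolding \<psi>(3) q(2) mono[OF q(1)] by (simp only: mult.assoc)
      finally show ?thesis by (simp add: hsingle_mult)
    qed
    then show ?thesis using l0[OF q(1)]
      by (intro exI[of _ "l (nat b) powi a"] exI[of _ ?u]) (simp add: fps_compose_nth_0)
  qed
  then obtain c u where "\<And>q. c q \<noteq> 0 \<and> fps_nth (u q) 0 = 1 \<and>
      (\<forall>a. \<psi> (hsingle q a) = hsingle (of_nat n * q) (a * c q) * power_series (u q))" by metis
  then show ?thesis using that[OF \<psi>(1) hom cont] by blast
qed

text \<open>
  Since \<open>\<phi>\<close> multiplies exponents by \<open>n\<close>, it turns the action of \<open>\<omega>\<^sup>n\<close> on the source into the action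
  of \<open>\<omega>\<close> on the target; on \<open>y\<close> this needs that \<open>\<omega>\<close> fixes \<open>\<phi> rvar\<close>.
\<close>

lemma skew_endo_twist:
  fixes \<phi> :: "'k::field_char_0 ratfun \<Rightarrow> 'k ratfun"
  assumes r: "0 < r" "r < 1" and \<phi>: "puiseux_skew_endo r n \<phi>"
    and \<omega>: "\<omega> \<in> galois_characters" and fixed: "ratfun_map (twist \<omega>) (\<phi> rvar) = \<phi> rvar"
  shows "ratfun_map (twist \<omega>) (\<phi> f) = \<phi> (ratfun_map (twist (\<omega> ^ n)) f)"
proof -
  obtain \<psi> c u where \<psi>: "\<And>f. \<phi> (rconst f) = rconst (\<psi> f)" "is_ring_hom \<psi>" "adically_continuous \<psi>"
    "\<And>q a. \<psi> (hsingle q a) = hsingle (of_nat n * q) (a * c q) * power_series (u q)"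
    using puiseux_skew_endoE[OF r \<phi>] by metis
  have \<phi>hom: "is_ring_hom \<phi>" using \<phi> unfolding puiseux_skew_endo_def by blast
  interpret X: mult_subgroup "galois_characters :: (rat \<Rightarrow> 'k) set"
    by (rule mult_subgroup_galois_characters)
  have \<omega>n: "\<omega> ^ n \<in> galois_characters" by (rule X.power_closed[OF \<omega>])
  note T = ring_hom_twist[OF \<omega>] and Tn = ring_hom_twist[OF \<omega>n]
  have iso: "adically_continuous (twist \<eta>)" if "\<eta> \<in> galois_characters" for \<eta> :: "rat \<Rightarrow> 'k"
    by (rule adically_continuous_isometry[OF r]) (rule habs_twist[OF that])
  have "(\<lambda>f. twist \<omega> (\<psi> f)) = (\<lambda>f. \<psi> (twist (\<omega> ^ n) f))"
  proof (rule ring_hom_eqI_monomials)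
    fix q a
    have ps: "twist \<omega> (power_series (u q)) = power_series (u q)"
      by (rule twist_laurent[OF \<omega>]) (simp add: power_series_def)
    show "twist \<omega> (\<psi> (hsingle q a)) = \<psi> (twist (\<omega> ^ n) (hsingle q a))"
      unfolding \<psi>(4) twist_single ring_hom_mult[OF T] ps power_fun galois_charactersD(6)[OF \<omega>]
      by (simp only: mult.assoc)
  qed (rule ring_hom_comp[OF T \<psi>(2)] ring_hom_comp[OF \<psi>(2) Tn]
      adically_continuous_comp[OF iso[OF \<omega>] \<psi>(3)] adically_continuous_comp[OF \<psi>(3) iso[OF \<omega>n]])+
  then have \<psi>T: "twist \<omega> (\<psi> f) = \<psi> (twist (\<omega> ^ n) f)" for f by metis
  have "(\<lambda>f. ratfun_map (twist \<omega>) (\<phi> f)) = (\<lambda>f. \<phi> (ratfun_map (twist (\<omega> ^ n)) f))"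
  proof (rule ratfun_ring_hom_eqI)
    show "ratfun_map (twist \<omega>) (\<phi> (rconst a)) = \<phi> (ratfun_map (twist (\<omega> ^ n)) (rconst a))" for a
      by (simp add: \<psi>(1) ratfun_map_rconst T Tn \<psi>T)
    show "ratfun_map (twist \<omega>) (\<phi> rvar) = \<phi> (ratfun_map (twist (\<omega> ^ n)) rvar)"
      by (simp add: fixed ratfun_map_rvar Tn)
  qed (rule ring_hom_comp[OF ring_hom_ratfun_map[OF T] \<phi>hom]
      ring_hom_comp[OF \<phi>hom ring_hom_ratfun_map[OF Tn]])+
  then show ?thesis by metis
qed

lemma enat_dvd_infinity: "a \<noteq> 0 \<Longrightarrow> a dvd (\<infinity> :: enat)"
  by (rule dvdI[of _ _ \<infinity>]) (simp add: imult_infinity_right zero_less_iff_neq_zero)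

lemma enat_dvd_iff [simp]: "enat a dvd enat b \<longleftrightarrow> a dvd b"
proof
  assume "enat a dvd enat b"
  then obtain c where c: "enat b = enat a * c" by (rule dvdE)
  show "a dvd b"
  proof (cases c)
    case infinity
    then have "b = 0" using c by (simp add: zero_enat_def split: if_splits)
    then show ?thesis by simp
  qed (use c in auto)
next
  assume "a dvd b"
  then obtain c where "enat b = enat a * enat c" by (auto elim: dvdE)
  then show "enat a dvd enat b" by (rule dvdI)
qed

lemma point_mult_eq:
  assumes "0 < r" "r < 1"
  shows "point_mult r \<zeta> =
    ecard ((\<lambda>\<omega>. galois_point (twist \<omega>) \<zeta>) ` (galois_characters ::
      (rat \<Rightarrow> 'k::{alg_closed_field, field_char_0}) set))"
  by (simp add: point_mult_def galois_eq_twists[OF assms] image_image)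

lemma skew_mult_eq:
  assumes "0 < r" "r < 1"
  shows "skew_mult r \<phi> =
    ecard ((\<lambda>\<omega>. ratfun_map (twist \<omega>) (\<phi> rvar)) ` (galois_characters ::
      (rat \<Rightarrow> 'k::{alg_closed_field, field_char_0}) set))"
  by (simp add: skew_mult_def galois_eq_twists[OF assms] image_image)

lemma point_mult_nonzero: "0 < r \<Longrightarrow> r < 1 \<Longrightarrow> point_mult r \<zeta> \<noteq> 0"
  for \<zeta> :: "'k::{alg_closed_field, field_char_0} ratfun \<Rightarrow> ennreal"
  using galois_characters_one by (auto simp: point_mult_eq ecard_def zero_enat_def)

text \<open>
  Let \<open>L\<close> be a common multiple of the two multiplicities. An \<open>L\<close>-th power in the Galois group fixes
  both \<open>\<zeta>\<close> and \<open>\<phi> rvar\<close>, so its \<open>n\<close>-th power fixes the image of \<open>\<zeta>\<close>. The \<open>n L\<close>-th powers are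
  exactly the characters trivial at \<open>1/(n L)\<close>, an \<open>n L\<close>-th root of \<open>\<omega>\<close> being \<open>q \<mapsto> \<omega> (q/(n L))\<close>.
\<close>

lemma point_mult_skew_product_dvd:
  fixes \<phi> :: "'k::{alg_closed_field, field_char_0} ratfun \<Rightarrow> 'k ratfun"
  assumes r: "0 < r" "r < 1" and \<phi>: "puiseux_skew_endo r n \<phi>"
  shows "point_mult r (skew_product n \<phi> \<zeta>) dvd
    enat n * enat_lcm (point_mult r \<zeta>) (skew_mult r \<phi>)"
proof -
  have n: "n > 0" using \<phi> unfolding puiseux_skew_endo_def by blast
  let ?X = "galois_characters :: (rat \<Rightarrow> 'k) set"
  interpret X: mult_subgroup ?X by (rule mult_subgroup_galois_characters)
  let ?F = "\<lambda>\<omega> :: rat \<Rightarrow> 'k. galois_point (twist \<omega>) \<zeta>"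
  let ?E = "\<lambda>\<omega> :: rat \<Rightarrow> 'k. ratfun_map (twist \<omega>) (\<phi> rvar)"
  let ?D = "\<lambda>\<omega> :: rat \<Rightarrow> 'k. galois_point (twist \<omega>) (skew_product n \<phi> \<zeta>)"
  show ?thesis
  proof (cases "finite (?F ` ?X) \<and> finite (?E ` ?X)")
    case False
    then have "enat_lcm (point_mult r \<zeta>) (skew_mult r \<phi>) = \<infinity>"
      unfolding point_mult_eq[OF r] skew_mult_eq[OF r] by (auto simp: ecard_def)
    moreover have "enat n * \<infinity> = \<infinity>" using n by simp
    ultimately show ?thesis by (simp only: enat_dvd_infinity[OF point_mult_nonzero[OF r]])
  next
    case True
    define L where "L = lcm (card (?F ` ?X)) (card (?E ` ?X))"
    have L: "L > 0"
      using True X.one_closed unfolding L_def by (metis card_gt_0_iff empty_iff image_eqI lcm_pos_nat)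
    have power_fix: "F (\<omega> ^ L) = F 1" if F: "X.homogeneous F" "finite (F ` ?X)" "card (F ` ?X) dvd L"
      and \<omega>: "\<omega> \<in> ?X" for F :: "(rat \<Rightarrow> 'k) \<Rightarrow> 'z" and \<omega>
    proof -
      obtain e where e: "L = card (F ` ?X) * e" using F(3) by (rule dvdE)
      show ?thesis
        using X.homogeneous_power_card[OF F(1,2) X.power_closed[OF \<omega>, of e]]
        by (simp add: e power_mult[symmetric] mult.commute)
    qed
    have fixD: "?D \<omega> = ?D 1" if \<omega>: "\<omega> \<in> ?X" and triv: "\<omega> (1 / of_nat (n * L)) = 1" for \<omega>
    proof -
      define \<nu> where "\<nu> q = \<omega> (q / of_nat (n * L))" for q
      have \<nu>: "\<nu> \<in> ?X"
        using triv galois_charactersD(2)[OF \<omega>]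
        by (auto simp: galois_characters_def \<nu>_def add_divide_distrib)
      have "\<nu> ^ (n * L) = \<omega>"
      proof
        fix q :: rat
        have "of_nat (n * L) * (q / of_nat (n * L)) = q" using n L by simp
        then show "(\<nu> ^ (n * L)) q = \<omega> q"
          unfolding power_fun \<nu>_def using galois_charactersD(6)[OF \<omega>] by metis
      qed
      define \<eta> where "\<eta> = \<nu> ^ L"
      have \<eta>: "\<eta> \<in> ?X" unfolding \<eta>_def by (rule X.power_closed[OF \<nu>])
      have \<omega>_eq: "\<omega> = \<eta> ^ n"
        using \<open>\<nu> ^ (n * L) = \<omega>\<close> by (simp add: \<eta>_def power_mult[symmetric] mult.commute)
      let ?i = "\<lambda>q. inverse (\<eta> q)"
      have i: "?i \<in> ?X" by (rule galois_characters_inverse[OF \<eta>])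
      have "?F \<eta> = ?F 1"
        unfolding \<eta>_def by (rule power_fix[OF homogeneous_galois_point]) (use True \<nu> in \<open>auto simp: L_def\<close>)
      then have fix_point: "\<zeta> (ratfun_map (twist ?i) f) = \<zeta> f" for f
        unfolding galois_point_one by (metis galois_point_def inv_twist[OF \<eta>])
      have "?E \<eta> = ?E 1"
        unfolding \<eta>_def by (rule power_fix[OF homogeneous_ratfun_map]) (use True \<nu> in \<open>auto simp: L_def\<close>)
      then have "ratfun_map (twist \<eta>) (\<phi> rvar) = \<phi> rvar" by (simp only: ratfun_map_twist_one)
      then have "ratfun_map (twist ?i) (\<phi> rvar) = ratfun_map (twist (?i * \<eta>)) (\<phi> rvar)"
        by (simp only: ratfun_map_twist_times[OF i \<eta>])
      also have "?i * \<eta> = 1" using times_inverse_character[OF \<eta>] by (simp only: mult.commute)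
      finally have fix_var: "ratfun_map (twist ?i) (\<phi> rvar) = \<phi> rvar" by (simp only: ratfun_map_twist_one)
      have inv\<omega>: "(\<lambda>q. inverse (\<omega> q)) = ?i ^ n"
        by (rule ext) (simp add: \<omega>_eq power_fun power_inverse)
      have "\<zeta> (\<phi> (ratfun_map (inv (twist \<omega>)) f)) = \<zeta> (\<phi> f)" for f
        unfolding inv_twist[OF \<omega>] inv\<omega> skew_endo_twist[OF r \<phi> i fix_var, symmetric] by (rule fix_point)
      then show ?thesis
        unfolding galois_point_one by (simp add: galois_point_def skew_product_def)
    qed
    have nL: "n * L > 0" using n L by simp
    note D = galois_orbit_card_dvd[OF homogeneous_galois_point[of "skew_product n \<phi> \<zeta>"] nL fixD]
    show ?thesis
      unfolding point_mult_eq[OF r] skew_mult_eq[OF r]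
      using D True by (simp add: ecard_def L_def)
  qed
qed

section \<open>The Berkovich line as a set of extended seminorms\<close>

text \<open>
  An intrinsic description of the points, \<open>\<infinity>\<close> included, by their values on all rational functions.
  Multiplicativity is demanded for finite values only, since \<open>0 \<cdot> \<infinity>\<close> has no meaning here; inversion
  then governs the infinite values. Unlike the representation by seminorms on polynomials, this
  form does not single out the coordinate \<open>y\<close>, which a skew product need not respect.
\<close>

definition berk_seminorm :: "real \<Rightarrow> ('k::field ratfun \<Rightarrow> ennreal) \<Rightarrow> bool"
  where "berk_seminorm r v \<longleftrightarrow> (\<forall>f g. v (f + g) \<le> v f + v g) \<and>
    (\<forall>f g. v f \<noteq> top \<longrightarrow> v g \<noteq> top \<longrightarrow> v (f * g) = v f * v g) \<and>
    (\<forall>c. v (rconst c) = ennreal (habs r c)) \<and>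
    (\<forall>f. f \<noteq> 0 \<longrightarrow> v (inverse f) = inverse (v f))"

lemma berk_seminormI:
  assumes "\<And>f g. v f \<noteq> top \<Longrightarrow> v g \<noteq> top \<Longrightarrow> v (f + g) \<le> v f + v g"
    and "\<And>f g. v f \<noteq> top \<Longrightarrow> v g \<noteq> top \<Longrightarrow> v (f * g) = v f * v g"
    and "\<And>c. v (rconst c) = ennreal (habs r c)"
    and "\<And>f. f \<noteq> 0 \<Longrightarrow> v (inverse f) = inverse (v f)"
  shows "berk_seminorm r v"
proof -
  have "v (f + g) \<le> v f + v g" for f g
    using assms(1)[of f g] by (cases "v f = top \<or> v g = top") auto
  then show ?thesis using assms(2-4) by (simp add: berk_seminorm_def)
qed

lemma habs_one:
  assumes "0 < r"
  shows "habs r (1 :: 'k::zero_neq_one puiseux_hat) = 1"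
proof -
  have "hval (1 :: 'k puiseux_hat) = 0" by (rule hval_eqI) (auto simp: hcoeff_one)
  moreover have "(1 :: 'k puiseux_hat) \<noteq> 0"
    using hcoeff_one[of 0] hcoeff_zero[of 0] zero_neq_one by metis
  ultimately show ?thesis using assms by (simp add: habs_def)
qed

lemma habs_zero [simp]: "habs r 0 = 0"
  by (simp add: habs_def)

lemma habs_eq_0_iff: "0 < r \<Longrightarrow> habs r f = 0 \<longleftrightarrow> f = 0"
  by (simp add: habs_def)

lemma habs_divide:
  fixes f g :: "'k::field puiseux_hat"
  assumes "0 < r"
  shows "habs r (f / g) = habs r f / habs r g"
proof (cases "g = 0")
  case False
  then have "habs r (f / g) * habs r g = habs r f" by (simp flip: habs_mult)
  then show ?thesis using False habs_eq_0_iff[OF assms, of g] by (simp add: field_simps)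
qed simp

subsection \<open>Seminorms on polynomials\<close>

context
  fixes r :: real and s :: "'k::field puiseux_hat poly \<Rightarrow> real"
  assumes r: "0 < r" and s: "mult_seminorm r s"
begin

lemma seminorm_nonneg: "0 \<le> s P"
  and seminorm_add: "s (P + Q) \<le> s P + s Q"
  and seminorm_mult: "s (P * Q) = s P * s Q"
  and seminorm_const: "s [:c:] = habs r c"
  using s unfolding mult_seminorm_def by blast+

lemma seminorm_zero: "s 0 = 0" and seminorm_one: "s 1 = 1"
  using seminorm_const[of 0] seminorm_const[of 1] habs_one[OF r] by (simp_all add: one_pCons)

text \<open>
  The polynomials with \<open>s P = 0\<close> form an ideal, hence are the multiples of a single polynomial \<open>D\<close>,
  and common factors \<open>D\<close> can be removed from numerator and denominator.
\<close>

lemma ex_good_representation: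
  "\<exists>P Q. f = Fraction_Field.Fract P Q \<and> Q \<noteq> 0 \<and> (s P \<noteq> 0 \<or> s Q \<noteq> 0)"
proof -
  \<comment> \<open>choose a representation with denominator of least degree, so that no common factor is left\<close>
  define rep where "rep d \<longleftrightarrow> (\<exists>P Q. f = Fraction_Field.Fract P Q \<and> Q \<noteq> 0 \<and> degree Q = d)" for d
  have "\<exists>d. rep d" unfolding rep_def by (cases f) auto
  then have "rep (LEAST d. rep d)" by (rule LeastI_ex)
  then obtain P Q where PQ: "f = Fraction_Field.Fract P Q" "Q \<noteq> 0" "degree Q = (LEAST d. rep d)"
    unfolding rep_def by blast
  have "s P \<noteq> 0 \<or> s Q \<noteq> 0"
  proof (rule ccontr)
    assume "\<not> (s P \<noteq> 0 \<or> s Q \<noteq> 0)"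
    then have 0: "s P = 0" "s Q = 0" by auto
    define k where "k d \<longleftrightarrow> (\<exists>A. A \<noteq> 0 \<and> s A = 0 \<and> degree A = d)" for d
    have "\<exists>d. k d" using 0 PQ(2) unfolding k_def by blast
    then have "k (LEAST d. k d)" by (rule LeastI_ex)
    then obtain D where D: "D \<noteq> 0" "s D = 0" "degree D = (LEAST d. k d)"
      unfolding k_def by blast
    have dvd: "D dvd A" if A: "s A = 0" for A
    proof (rule ccontr)
      assume "\<not> D dvd A"
      then have nz: "A mod D \<noteq> 0" by (simp add: dvd_eq_mod_eq_0)
      have "A mod D = A + (- (A div D)) * D" by (simp add: minus_div_mult_eq_mod[symmetric])
      then have "s (A mod D) \<le> s A + s (- (A div D)) * s D"
        using seminorm_add seminorm_mult by metis
      then have "s (A mod D) = 0" using A D(2) seminorm_nonneg[of "A mod D"] by simp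
      then have "k (degree (A mod D))" using nz unfolding k_def by blast
      then have "degree D \<le> degree (A mod D)" unfolding D(3) by (rule Least_le)
      then show False using degree_mod_less[OF D(1), of A] nz by simp
    qed
    obtain P' where P': "P = D * P'" using dvd[OF 0(1)] by (rule dvdE)
    obtain Q' where Q': "Q = D * Q'" using dvd[OF 0(2)] by (rule dvdE)
    have Q'0: "Q' \<noteq> 0" using PQ(2) Q' by auto
    have "degree D \<noteq> 0"
    proof
      assume "degree D = 0"
      then obtain c where "D = [:c:]" by (rule degree_eq_zeroE)
      then show False using D(1,2) seminorm_const[of c] habs_eq_0_iff[OF r, of c] by simp
    qed
    moreover have "f = Fraction_Field.Fract P' Q'"
      unfolding PQ(1) P' Q' using D(1) Q'0 by (simp add: eq_fract mult.assoc mult.left_commute)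
    then have "rep (degree Q')" using Q'0 unfolding rep_def by blast
    then have "degree Q \<le> degree Q'" unfolding PQ(3) by (rule Least_le)
    ultimately show False using degree_mult_eq[OF D(1) Q'0] Q' by simp
  qed
  then show ?thesis using PQ by blast
qed

lemma ratfun_seminorm_pole:
  assumes Q: "Q \<noteq> 0" "s Q = 0" and P: "s P \<noteq> 0"
  shows "ratfun_seminorm s (Fraction_Field.Fract P Q) = top"
proof -
  have "s Q' = 0" if "Fraction_Field.Fract P Q = Fraction_Field.Fract P' Q'" for P' Q'
  proof (cases "Q' = 0")
    case False
    then have "P * Q' = P' * Q" using that Q(1) by (simp add: eq_fract)
    then have "s P * s Q' = s P' * s Q" by (simp flip: seminorm_mult)
    then show ?thesis using P Q(2) by simp
  qed (simp add: seminorm_zero)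
  then have "{ennreal (s P' / s Q') | P' Q'.
    Fraction_Field.Fract P Q = Fraction_Field.Fract P' Q' \<and> s Q' \<noteq> 0} = {}" by blast
  then show ?thesis unfolding ratfun_seminorm_def by (simp only: Inf_empty)
qed

lemma ratfun_seminorm_finite:
  assumes "ratfun_seminorm s f \<noteq> top"
  obtains P Q where "f = Fraction_Field.Fract P Q" "s Q \<noteq> 0" "Q \<noteq> 0"
    "ratfun_seminorm s f = ennreal (s P / s Q)"
proof -
  obtain P Q where f: "f = Fraction_Field.Fract P Q" "Q \<noteq> 0" "s P \<noteq> 0 \<or> s Q \<noteq> 0"
    using ex_good_representation by blast
  have "s Q \<noteq> 0" using assms f ratfun_seminorm_pole by auto
  then show ?thesis using that[OF f(1)] f(1,2) ratfun_seminorm_Fract[OF s] by simp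
qed

lemma berk_seminorm_ratfun_seminorm: "berk_seminorm r (ratfun_seminorm s)"
proof (rule berk_seminormI)
  fix f g assume "ratfun_seminorm s f \<noteq> top" "ratfun_seminorm s g \<noteq> top"
  then obtain P Q P' Q' where f: "f = Fraction_Field.Fract P Q" "s Q \<noteq> 0" "Q \<noteq> 0"
      "ratfun_seminorm s f = ennreal (s P / s Q)"
    and g: "g = Fraction_Field.Fract P' Q'" "s Q' \<noteq> 0" "Q' \<noteq> 0"
      "ratfun_seminorm s g = ennreal (s P' / s Q')"
    using ratfun_seminorm_finite by metis
  have QQ: "s (Q * Q') \<noteq> 0" using f(2) g(2) by (simp add: seminorm_mult)
  have pos: "s Q > 0" "s Q' > 0" using f(2) g(2) seminorm_nonneg by (simp_all add: less_le)
  have "f + g = Fraction_Field.Fract (P * Q' + P' * Q) (Q * Q')" using f g by simp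
  then have "ratfun_seminorm s (f + g) = ennreal (s (P * Q' + P' * Q) / s (Q * Q'))"
    by (simp only: ratfun_seminorm_Fract[OF s, OF QQ])
  also have "\<dots> \<le> ennreal ((s P * s Q' + s P' * s Q) / (s Q * s Q'))"
    unfolding seminorm_mult using seminorm_add[of "P * Q'" "P' * Q"] pos
    by (intro ennreal_leI divide_right_mono) (auto simp: seminorm_mult)
  also have "(s P * s Q' + s P' * s Q) / (s Q * s Q') = s P / s Q + s P' / s Q'"
    using pos by (simp add: add_divide_distrib)
  also have "ennreal \<dots> = ratfun_seminorm s f + ratfun_seminorm s g"
    unfolding f(4) g(4) using pos seminorm_nonneg by (simp add: ennreal_plus)
  finally show "ratfun_seminorm s (f + g) \<le> ratfun_seminorm s f + ratfun_seminorm s g" .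
  have "f * g = Fraction_Field.Fract (P * P') (Q * Q')" using f g by simp
  then have "ratfun_seminorm s (f * g) = ennreal (s (P * P') / s (Q * Q'))"
    by (simp only: ratfun_seminorm_Fract[OF s, OF QQ])
  also have "\<dots> = ennreal (s P / s Q * (s P' / s Q'))" by (simp add: seminorm_mult)
  also have "\<dots> = ratfun_seminorm s f * ratfun_seminorm s g"
    unfolding f(4) g(4) by (rule ennreal_mult) (use pos seminorm_nonneg in simp_all)
  finally show "ratfun_seminorm s (f * g) = ratfun_seminorm s f * ratfun_seminorm s g" .
next
  fix c
  have "s 1 \<noteq> 0" by (simp add: seminorm_one)
  from ratfun_seminorm_Fract[OF s this, of "[:c:]"]
  show "ratfun_seminorm s (rconst c) = ennreal (habs r c)"
    by (simp add: rconst_def seminorm_one seminorm_const)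
next
  fix f :: "'k ratfun" assume "f \<noteq> 0"
  obtain P Q where f: "f = Fraction_Field.Fract P Q" "Q \<noteq> 0" "s P \<noteq> 0 \<or> s Q \<noteq> 0"
    using ex_good_representation by blast
  have P: "P \<noteq> 0" using \<open>f \<noteq> 0\<close> f(1,2) by (auto simp: Zero_fract_def eq_fract)
  have i: "inverse f = Fraction_Field.Fract Q P" using f by simp
  show "ratfun_seminorm s (inverse f) = inverse (ratfun_seminorm s f)"
  proof (cases "s P = 0 \<or> s Q = 0")
    case True
    then show ?thesis
      unfolding i f(1) using f(2,3) P
      by (elim disjE) (simp_all add: ratfun_seminorm_pole ratfun_seminorm_Fract[OF s])
  next
    case False
    then have "s P / s Q > 0" using seminorm_nonneg[of P] seminorm_nonneg[of Q] by (simp add: less_le)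
    then show ?thesis
      unfolding i f(1) using False by (simp add: ratfun_seminorm_Fract[OF s] inverse_ennreal)
  qed
qed

end

subsection \<open>The point at infinity\<close>

lemma coeff_mult_degree_le:
  fixes A B :: "'a::comm_semiring_0 poly"
  assumes "degree A \<le> a" "degree B \<le> b"
  shows "poly.coeff (A * B) (a + b) = poly.coeff A a * poly.coeff B b"
proof -
  have "poly.coeff A i * poly.coeff B (a + b - i) = 0" if "i \<noteq> a" for i
  proof (cases "i < a")
    case True
    then have "degree B < a + b - i" using assms(2) by simp
    then show ?thesis by (simp add: coeff_eq_0)
  next
    case False
    then have "degree A < i" using assms(1) that by simp
    then show ?thesis by (simp add: coeff_eq_0)
  qed
  then have "poly.coeff (A * B) (a + b) = (\<Sum>i\<le>a + b. if i = a then poly.coeff A a * poly.coeff B b else 0)"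
    unfolding coeff_mult by (intro sum.cong) auto
  then show ?thesis by simp
qed

lemma berk_seminorm_berk_infinity:
  assumes r: "0 < r" "r < 1"
  shows "berk_seminorm r (berk_infinity r :: 'k::field ratfun \<Rightarrow> _)"
proof (rule berk_seminormI)
  fix f g :: "'k ratfun"
  assume fin: "berk_infinity r f \<noteq> top" "berk_infinity r g \<noteq> top"
  obtain P Q where f: "f = Fraction_Field.Fract P Q" "Q \<noteq> 0" by (cases f)
  obtain P' Q' where g: "g = Fraction_Field.Fract P' Q'" "Q' \<noteq> 0" by (cases g)
  have deg: "degree P \<le> degree Q" "degree P' \<le> degree Q'"
    using fin f g by (auto simp: berk_infinity_Fract split: if_splits)
  have QQ: "Q * Q' \<noteq> 0" and dQQ: "degree (Q * Q') = degree Q + degree Q'"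
    using f(2) g(2) by (simp_all add: degree_mult_eq)
  let ?a = "poly.coeff P (degree Q) / lead_coeff Q" and ?b = "poly.coeff P' (degree Q') / lead_coeff Q'"
  have vf: "berk_infinity r f = ennreal (habs r ?a)" and vg: "berk_infinity r g = ennreal (habs r ?b)"
    using deg f g by (simp_all add: berk_infinity_Fract)
  have dle: "degree (A * B) \<le> degree Q + degree Q'" if "degree A \<le> degree Q" "degree B \<le> degree Q'"
    for A B :: "'k puiseux_hat poly"
    using degree_mult_le[of A B] that by linarith
  have "f + g = Fraction_Field.Fract (P * Q' + Q * P') (Q * Q')" using f g by (simp add: mult.commute)
  moreover have "degree (P * Q' + Q * P') \<le> degree (Q * Q')"
    unfolding dQQ by (rule degree_add_le; rule dle) (use deg in auto)
  moreover have "poly.coeff (P * Q' + Q * P') (degree (Q * Q')) / lead_coeff (Q * Q') = ?a + ?b"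
    unfolding dQQ coeff_add coeff_mult_degree_le[OF deg(1) order_refl]
      coeff_mult_degree_le[OF order_refl deg(2)] coeff_mult_degree_le[OF order_refl order_refl]
    using f(2) g(2) by (simp add: field_simps)
  ultimately have "berk_infinity r (f + g) = ennreal (habs r (?a + ?b))"
    using berk_infinity_Fract[OF QQ] by simp
  also have "habs r (?a + ?b) \<le> habs r ?a + habs r ?b"
    using habs_add_le[OF r, of ?a ?b] habs_nonneg[of r ?a] habs_nonneg[of r ?b] by linarith
  finally show "berk_infinity r (f + g) \<le> berk_infinity r f + berk_infinity r g"
    unfolding vf vg by (simp add: ennreal_leI habs_nonneg flip: ennreal_plus)
  have "f * g = Fraction_Field.Fract (P * P') (Q * Q')" using f g by simp
  moreover have "degree (P * P') \<le> degree (Q * Q')"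
    unfolding dQQ by (rule dle) (use deg in auto)
  moreover have "poly.coeff (P * P') (degree (Q * Q')) / lead_coeff (Q * Q') = ?a * ?b"
    unfolding dQQ using deg by (simp add: coeff_mult_degree_le)
  ultimately have "berk_infinity r (f * g) = ennreal (habs r (?a * ?b))"
    using berk_infinity_Fract[OF QQ] by simp
  then show "berk_infinity r (f * g) = berk_infinity r f * berk_infinity r g"
    unfolding vf vg habs_mult by (simp only: ennreal_mult habs_nonneg)
next
  fix c :: "'k puiseux_hat"
  show "berk_infinity r (rconst c) = ennreal (habs r c)"
    by (simp add: rconst_def berk_infinity_Fract)
next
  fix f :: "'k ratfun" assume "f \<noteq> 0"
  obtain P Q where f: "f = Fraction_Field.Fract P Q" "Q \<noteq> 0" by (cases f)
  have P: "P \<noteq> 0" using \<open>f \<noteq> 0\<close> f by (auto simp: Zero_fract_def eq_fract)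
  have i: "inverse f = Fraction_Field.Fract Q P" using f by simp
  \<comment> \<open>a zero, a finite nonzero value, or a pole at \<open>\<infinity>\<close>\<close>
  consider "degree P < degree Q" | "degree P = degree Q" | "degree Q < degree P" by linarith
  then show "berk_infinity r (inverse f) = inverse (berk_infinity r f)"
  proof cases
    case 1
    then show ?thesis unfolding i f(1) using f(2) P by (simp add: berk_infinity_Fract coeff_eq_0)
  next
    case 3
    then show ?thesis unfolding i f(1) using f(2) P by (simp add: berk_infinity_Fract coeff_eq_0)
  next
    case 2
    have nz: "habs r (lead_coeff P) > 0" "habs r (lead_coeff Q) > 0"
      using f(2) P habs_eq_0_iff[OF r(1)] habs_nonneg by (metis leading_coeff_0_iff less_le)+
    have "habs r (lead_coeff Q / lead_coeff P) = inverse (habs r (lead_coeff P / lead_coeff Q))"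
      by (simp add: habs_divide[OF r(1)])
    moreover have "habs r (lead_coeff P / lead_coeff Q) > 0"
      using nz by (simp add: habs_divide[OF r(1)])
    ultimately show ?thesis
      unfolding i f(1) using f(2) P 2 by (simp add: berk_infinity_Fract inverse_ennreal)
  qed
qed

subsection \<open>Every extended seminorm is a point\<close>

context
  fixes r :: real and v :: "'k::field ratfun \<Rightarrow> ennreal"
  assumes r: "0 < r" "r < 1" and v: "berk_seminorm r v"
begin

lemma berk_add: "v (f + g) \<le> v f + v g"
  and berk_mult: "v f \<noteq> top \<Longrightarrow> v g \<noteq> top \<Longrightarrow> v (f * g) = v f * v g"
  and berk_const: "v (rconst c) = ennreal (habs r c)"
  and berk_inverse: "f \<noteq> 0 \<Longrightarrow> v (inverse f) = inverse (v f)"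
  using v unfolding berk_seminorm_def by blast+

lemma berk_zero: "v 0 = 0"
  using berk_const[of 0] by (simp add: ring_hom_zero[OF ring_hom_rconst])

lemma berk_one: "v 1 = 1"
  using berk_const[of 1] by (simp add: ring_hom_one[OF ring_hom_rconst] habs_one[OF r(1)])

lemma berk_finite:
  "v f \<noteq> top \<Longrightarrow> v g \<noteq> top \<Longrightarrow> v (f + g) \<noteq> top"
  "v f \<noteq> top \<Longrightarrow> v g \<noteq> top \<Longrightarrow> v (f * g) \<noteq> top"
  using berk_add[of f g] by (auto simp: berk_mult ennreal_mult_eq_top_iff top_unique)

lemma berk_finite_poly:
  assumes "v rvar \<noteq> top"
  shows "v (Fraction_Field.Fract P 1) \<noteq> top"
proof (induction P)
  case 0
  then show ?case using berk_zero by (simp add: Zero_fract_def)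
next
  case (pCons a P)
  then show ?case unfolding Fract_pCons using assms by (simp add: berk_finite berk_const)
qed

lemma berk_finite_point:
  assumes fin: "v rvar \<noteq> top"
  shows "v \<in> berk_line r"
proof -
  define s where "s P = enn2real (v (Fraction_Field.Fract P 1))" for P
  have s: "ennreal (s P) = v (Fraction_Field.Fract P 1)" for P
    using berk_finite_poly[OF fin] by (simp add: s_def less_top)
  have s0: "0 \<le> s P" for P by (simp add: s_def)
  have m: "mult_seminorm r s"
    unfolding mult_seminorm_def
  proof (intro conjI allI)
    fix P Q c
    show "0 \<le> s P" by (rule s0)
    have "v (Fraction_Field.Fract P 1 + Fraction_Field.Fract Q 1) \<le> ennreal (s P) + ennreal (s Q)"
      unfolding s by (rule berk_add)
    then have "ennreal (s (P + Q)) \<le> ennreal (s P + s Q)"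
      using s0 by (simp add: s ennreal_plus)
    then show "s (P + Q) \<le> s P + s Q" using s0 by (metis ennreal_le_iff add_nonneg_nonneg)
    have "v (Fraction_Field.Fract P 1 * Fraction_Field.Fract Q 1) = ennreal (s P) * ennreal (s Q)"
      unfolding s by (rule berk_mult) (rule berk_finite_poly[OF fin])+
    then have "ennreal (s (P * Q)) = ennreal (s P * s Q)"
      using s0 by (simp add: s ennreal_mult)
    then show "s (P * Q) = s P * s Q" using s0 by (simp add: ennreal_inj)
    show "s [:c:] = habs r c"
      using berk_const[of c] by (simp add: s_def rconst_def habs_nonneg)
  qed
  have "v f = ratfun_seminorm s f" for f
  proof -
    obtain P Q where f: "f = Fraction_Field.Fract P Q" "Q \<noteq> 0" "s P \<noteq> 0 \<or> s Q \<noteq> 0"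
      using ex_good_representation[OF r(1) m] by blast
    have nz: "Fraction_Field.Fract A 1 \<noteq> 0" if "A \<noteq> 0" for A :: "'k puiseux_hat poly"
      using that by (simp add: Zero_fract_def eq_fract)
    have eq: "f = Fraction_Field.Fract P 1 * inverse (Fraction_Field.Fract Q 1)"
      using f(2) by (simp add: f(1))
    show ?thesis
    proof (cases "s Q = 0")
      case False
      then have pos: "s Q > 0" using s0[of Q] by simp
      have "v (inverse (Fraction_Field.Fract Q 1)) = ennreal (inverse (s Q))"
        unfolding berk_inverse[OF nz[OF f(2)]] s[symmetric] by (rule inverse_ennreal[OF pos])
      then have "v f = ennreal (s P) * ennreal (inverse (s Q))"
        unfolding eq by (subst berk_mult) (simp_all add: s berk_finite_poly[OF fin])
      also have "\<dots> = ennreal (s P / s Q)" using s0 pos by (simp add: divide_inverse ennreal_mult)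
      finally show ?thesis unfolding f(1) ratfun_seminorm_Fract[OF m False] .
    next
      case True
      then have sP: "s P \<noteq> 0" using f(3) by simp
      then have P: "P \<noteq> 0" using seminorm_zero[OF r(1) m] by metis
      have vP: "v (inverse (Fraction_Field.Fract P 1)) \<noteq> top"
        unfolding berk_inverse[OF nz[OF P]] s[symmetric] using sP s0[of P] by (simp add: inverse_ennreal)
      have i: "inverse f = Fraction_Field.Fract Q 1 * inverse (Fraction_Field.Fract P 1)"
        using P f(2) by (simp add: f(1))
      have "v (inverse f) = 0"
        unfolding i berk_mult[OF berk_finite_poly[OF fin] vP] s[symmetric] True by simp
      moreover have "inverse f \<noteq> 0"
        unfolding i by (intro no_zero_divisors nonzero_imp_inverse_nonzero nz P f(2))
      ultimately have "v f = top" using berk_inverse[of "inverse f"] by simp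
      then show ?thesis unfolding f(1) ratfun_seminorm_pole[OF r(1) m f(2) True sP] .
    qed
  qed
  then have "v = ratfun_seminorm s" by (rule ext)
  then show ?thesis using m unfolding berk_line_def by blast
qed

lemma berk_perturb:
  assumes t: "v t = 0"
  shows "v (f + t) = v f"
proof (rule antisym)
  show "v (f + t) \<le> v f" using berk_add[of f t] t by simp
  have "v (rconst (- 1) * t) = 0" by (subst berk_mult) (simp_all add: t berk_const)
  then have "v (- t) = 0"
    by (simp add: ring_hom_uminus[OF ring_hom_rconst] ring_hom_one[OF ring_hom_rconst])
  then show "v f \<le> v (f + t)" using berk_add[of "f + t" "- t"] by simp
qed

lemma berk_power: "v f \<noteq> top \<Longrightarrow> v (f ^ k) = v f ^ k"
proof (induction k)
  case (Suc k)
  then show ?case by (simp add: berk_mult power_eq_top_ennreal)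
qed (simp add: berk_one)

text \<open>
  Expand \<open>P/y\<^sup>d\<close>, where \<open>d\<close> is the degree of \<open>P\<close>, in powers of \<open>1/y\<close>: all terms except the leading
  coefficient are multiples of \<open>1/y\<close> and have value \<open>0\<close>.
\<close>

lemma berk_leading_coefficient:
  assumes w: "v (inverse rvar) = 0" and P: "P \<noteq> 0"
  shows "v (Fraction_Field.Fract P 1 * inverse rvar ^ degree P) = ennreal (habs r (lead_coeff P))"
  using P
proof (induction P)
  case (pCons a P)
  let ?w = "inverse rvar :: 'k ratfun"
  have rv: "(rvar :: 'k ratfun) \<noteq> 0" by (simp add: rvar_def Zero_fract_def eq_fract)
  show ?case
  proof (cases "P = 0")
    case True
    then show ?thesis using berk_const[of a] by (simp add: rconst_def)
  next
    case False
    have "Fraction_Field.Fract (pCons a P) 1 * ?w ^ degree (pCons a P) =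
        (rconst a + rvar * Fraction_Field.Fract P 1) * (?w * ?w ^ degree P)"
      unfolding Fract_pCons using False by simp
    also have "\<dots> = Fraction_Field.Fract P 1 * ?w ^ degree P + rconst a * ?w ^ Suc (degree P)"
      using rv by (simp add: field_simps)
    also have "v \<dots> = v (Fraction_Field.Fract P 1 * ?w ^ degree P)"
    proof (rule berk_perturb)
      have "v (?w ^ Suc (degree P)) = 0" using berk_power[of ?w "Suc (degree P)"] w by simp
      then show "v (rconst a * ?w ^ Suc (degree P)) = 0"
        by (subst berk_mult) (simp_all add: berk_const)
    qed
    finally show ?thesis using pCons.IH[OF False] False by simp
  qed
qed simp

lemma berk_infinite_point:
  assumes inf: "v rvar = top"
  shows "v \<in> berk_line r"
proof -
  let ?w = "inverse rvar :: 'k ratfun"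
  have rv: "(rvar :: 'k ratfun) \<noteq> 0" by (simp add: rvar_def Zero_fract_def eq_fract)
  have w: "v ?w = 0" using berk_inverse[OF rv] inf by simp
  have wk: "v (?w ^ k) = 0 ^ k" for k using w by (simp add: berk_power)
  have nz: "Fraction_Field.Fract A 1 \<noteq> 0" if "A \<noteq> 0" for A :: "'k puiseux_hat poly"
    using that by (simp add: Zero_fract_def eq_fract)
  have le: "v (Fraction_Field.Fract P Q) =
      (if degree P = degree Q then ennreal (habs r (lead_coeff P / lead_coeff Q)) else 0)"
    if PQ: "P \<noteq> 0" "Q \<noteq> 0" "degree P \<le> degree Q" for P Q
  proof -
    let ?U = "\<lambda>P. Fraction_Field.Fract P 1 * ?w ^ degree P"
    have pos: "habs r (lead_coeff Q) > 0"
      using PQ(2) habs_eq_0_iff[OF r(1)] habs_nonneg by (metis leading_coeff_0_iff less_le)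
    have U0: "?U Q \<noteq> 0" using nz[OF PQ(2)] rv by simp
    have i: "v (inverse (?U Q)) = ennreal (inverse (habs r (lead_coeff Q)))"
      unfolding berk_inverse[OF U0] berk_leading_coefficient[OF w PQ(2)] by (rule inverse_ennreal[OF pos])
    have top: "v (?U P) \<noteq> top" "v (inverse (?U Q)) \<noteq> top" "v (?w ^ (degree Q - degree P)) \<noteq> top"
      unfolding i wk berk_leading_coefficient[OF w PQ(1)] by (simp_all add: power_eq_top_ennreal)
    have "Fraction_Field.Fract P Q = Fraction_Field.Fract P 1 * inverse (Fraction_Field.Fract Q 1)"
      using PQ(2) by simp
    also have "\<dots> = ?U P * inverse (?U Q) * ?w ^ (degree Q - degree P)"
      using rv PQ(3) nz[OF PQ(2)] by (simp add: field_simps flip: power_add)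
    also have "v \<dots> = ennreal (habs r (lead_coeff P)) * ennreal (inverse (habs r (lead_coeff Q))) *
        0 ^ (degree Q - degree P)"
      unfolding berk_mult[OF berk_finite(2)[OF top(1,2)] top(3)] berk_mult[OF top(1,2)] i wk
        berk_leading_coefficient[OF w PQ(1)] ..
    also have "ennreal (habs r (lead_coeff P)) * ennreal (inverse (habs r (lead_coeff Q))) =
        ennreal (habs r (lead_coeff P / lead_coeff Q))"
      unfolding habs_divide[OF r(1)] unfolding divide_inverse
      by (rule ennreal_mult[symmetric]) (simp_all add: habs_nonneg)
    finally show ?thesis using PQ(3) by (auto simp: power_0_left)
  qed
  have "v f = berk_infinity r f" for f
  proof -
    obtain P Q where f: "f = Fraction_Field.Fract P Q" "Q \<noteq> 0" by (cases f)
    consider "P = 0" | "P \<noteq> 0" "degree P \<le> degree Q" | "P \<noteq> 0" "degree Q < degree P" by linarith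
    then show ?thesis
    proof cases
      case 1
      then have "f = 0" using f by (simp add: Zero_fract_def eq_fract)
      moreover have "berk_infinity r f = 0"
        unfolding f(1) berk_infinity_Fract[OF f(2)] using 1 by simp
      ultimately show ?thesis by (simp add: berk_zero)
    next
      case 2
      then show ?thesis unfolding f(1) by (simp add: le f(2) berk_infinity_Fract coeff_eq_0)
    next
      case 3
      then have i: "inverse f = Fraction_Field.Fract Q P" using f by simp
      have "v (inverse f) = 0" unfolding i using 3 by (simp add: le f(2))
      moreover have "inverse f \<noteq> 0" using 3 f(2) unfolding i by (simp add: Zero_fract_def eq_fract)
      ultimately have "v f = top" using berk_inverse[of "inverse f"] by simp
      then show ?thesis unfolding f(1) using 3 f(2) by (simp add: berk_infinity_Fract)
    qed
  qed
  then have "v = berk_infinity r" by (rule ext)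
  then show ?thesis unfolding berk_line_def by blast
qed

end

lemma berk_line_iff:
  assumes r: "0 < r" "r < 1"
  shows "v \<in> berk_line r \<longleftrightarrow> berk_seminorm r v"
proof
  assume "v \<in> berk_line r"
  then show "berk_seminorm r v"
    unfolding berk_line_def
    using berk_seminorm_ratfun_seminorm[OF r(1)] berk_seminorm_berk_infinity[OF r] by blast
next
  assume v: "berk_seminorm r v"
  show "v \<in> berk_line r"
    using berk_finite_point[OF r v] berk_infinite_point[OF r v] by blast
qed

section \<open>Skew products preserve the Berkovich line\<close>

lemma ennreal_root_ennreal: "0 \<le> t \<Longrightarrow> ennreal_root n (ennreal t) = ennreal (root n t)"
  by (simp add: ennreal_root_def)

text \<open>
  The triangle inequality survives the \<open>n\<close>-th root since \<open>a\<^sup>n + b\<^sup>n \<le> (a + b)\<^sup>n\<close>.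
\<close>

lemma root_add_le:
  assumes n: "n > 0" and a: "0 \<le> a" "0 \<le> b"
  shows "root n (a + b) \<le> root n a + root n b"
proof -
  have pw: "x ^ k + y ^ k \<le> (x + y) ^ k" if "k > 0" "0 \<le> x" "0 \<le> y" for x y :: real and k
    using that(1)
  proof (induction k rule: nat_induct_non_zero)
    case (Suc k)
    have "x ^ Suc k + y ^ Suc k \<le> (x + y) * (x ^ k + y ^ k)"
      using that by (simp add: algebra_simps)
    also have "\<dots> \<le> (x + y) * (x + y) ^ k" using Suc.IH that by (intro mult_left_mono) auto
    finally show ?case by simp
  qed simp
  have "a + b \<le> (root n a + root n b) ^ n"
    using pw[OF n, of "root n a" "root n b"] n a by simp
  then have "root n (a + b) \<le> root n ((root n a + root n b) ^ n)" using n by simp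
  then show ?thesis using n a by (simp add: real_root_power_cancel)
qed

text \<open>
  The image of \<open>f\<close> has valuation \<open>n\<close> times that of \<open>f\<close>, because its lowest term comes from the lowest
  term of \<open>f\<close> alone. This is what makes the \<open>n\<close>-th root restrict to \<open>habs r\<close> on constants.
\<close>

lemma skew_endo_habs:
  fixes \<phi> :: "'k::field_char_0 ratfun \<Rightarrow> 'k ratfun"
  assumes r: "0 < r" "r < 1" and \<phi>: "puiseux_skew_endo r n \<phi>"
  obtains g where "\<phi> (rconst f) = rconst g" "habs r g = habs r f ^ n"
proof -
  obtain \<psi> c u where \<psi>: "\<And>f. \<phi> (rconst f) = rconst (\<psi> f)" "is_ring_hom \<psi>" "adically_continuous \<psi>"
    "\<And>q a. \<psi> (hsingle q a) = hsingle (of_nat n * q) (a * c q) * power_series (u q)"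
    "\<And>q. c q \<noteq> 0" "\<And>q. fps_nth (u q) 0 = 1"
    using puiseux_skew_endoE[OF r \<phi>] by metis
  have n: "n > 0" using \<phi> unfolding puiseux_skew_endo_def by blast
  show ?thesis
  proof (cases "f = 0")
    case True
    then show ?thesis
      using that[OF \<psi>(1)] n by (simp add: ring_hom_zero[OF \<psi>(2)] power_0_left)
  next
    case False
    let ?m = "of_nat n * hval f"
    \<comment> \<open>beyond \<open>C\<close> the terms of \<open>f\<close> do not influence its image up to degree \<open>?m\<close>\<close>
    obtain C where C: "C \<ge> hval f"
      "\<And>f q. (\<And>p. p \<le> C \<Longrightarrow> hcoeff f p = 0) \<Longrightarrow> q \<le> ?m \<Longrightarrow> hcoeff (\<psi> f) q = 0"
      using adically_continuousE[OF \<psi>(3), of "hval f" ?m] by metis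
    let ?S = "{q. q \<le> C \<and> hcoeff f q \<noteq> 0}"
    define g where "g = f - truncation C f"
    have "f = truncation C f + g" by (simp add: g_def)
    then have "\<psi> f = \<psi> (truncation C f) + \<psi> g" using ring_hom_add[OF \<psi>(2)] by metis
    moreover have "hcoeff (\<psi> g) q = 0" if "q \<le> ?m" for q
      by (rule C(2)) (use that in \<open>auto simp: g_def hcoeff_truncation\<close>)
    ultimately have co: "hcoeff (\<psi> f) q = (\<Sum>p\<in>?S. hcoeff (\<psi> (hsingle p (hcoeff f p))) q)"
      if "q \<le> ?m" for q
      using that by (simp add: truncation_eq_sum ring_hom_sum[OF \<psi>(2)] hcoeff_sum)
    have S: "finite ?S" "hval f \<in> ?S" using finite_below hval(1)[OF False] C(1) by auto
    have term0: "hcoeff (\<psi> (hsingle p (hcoeff f p))) q = 0" if "q < of_nat n * p" for p q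
      using that by (simp add: \<psi>(4) hcoeff_single_mult hcoeff_power_series)
    have ge: "?m \<le> of_nat n * p" if "p \<in> ?S" for p
      using that hval_le[of f p] by (intro mult_left_mono) auto
    have "hval (\<psi> f) = ?m"
    proof (rule hval_eqI)
      have "hcoeff (\<psi> f) ?m = (\<Sum>p\<in>?S. if p = hval f then hcoeff f p * c p else 0)"
        unfolding co[OF order_refl]
      proof (rule sum.cong[OF refl])
        fix p assume p: "p \<in> ?S"
        show "hcoeff (\<psi> (hsingle p (hcoeff f p))) ?m = (if p = hval f then hcoeff f p * c p else 0)"
        proof (cases "p = hval f")
          case True
          then show ?thesis by (simp add: \<psi>(4,6) hcoeff_single_mult hcoeff_power_series)
        next
          case ne: False
          then have "?m < of_nat n * p" using n hval_le[of f p] p by simp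
          then show ?thesis using ne term0 by simp
        qed
      qed
      also have "\<dots> = hcoeff f (hval f) * c (hval f)" using S by simp
      finally show "hcoeff (\<psi> f) ?m \<noteq> 0" using \<psi>(5) hval(1)[OF False] by simp
    next
      fix q assume q: "q < ?m"
      show "hcoeff (\<psi> f) q = 0"
        unfolding co[OF less_imp_le[OF q]]
        by (rule sum.neutral) (use q ge term0 less_le_trans in blast)
    qed
    moreover have "\<psi> f \<noteq> 0" by (rule ring_hom_nonzero[OF \<psi>(2) False])
    ultimately have "habs r (\<psi> f) = habs r f ^ n"
      using False r by (simp add: habs_def of_rat_mult powr_powr[symmetric] powr_realpow
          mult.commute[of "of_nat n"] flip: powr_realpow)
    then show ?thesis using that[OF \<psi>(1)] by blast
  qed
qed

lemma skew_product_berk_line: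
  fixes \<phi> :: "'k::field_char_0 ratfun \<Rightarrow> 'k ratfun"
  assumes r: "0 < r" "r < 1" and \<phi>: "puiseux_skew_endo r n \<phi>" and \<zeta>: "\<zeta> \<in> berk_line r"
  shows "skew_product n \<phi> \<zeta> \<in> berk_line r"
proof -
  have n: "n > 0" and hom: "is_ring_hom \<phi>" using \<phi> unfolding puiseux_skew_endo_def by blast+
  have v: "berk_seminorm r \<zeta>" using \<zeta> berk_line_iff[OF r] by blast
  have top: "ennreal_root n t = top \<longleftrightarrow> t = top" for t by (simp add: ennreal_root_def)
  have "berk_seminorm r (skew_product n \<phi> \<zeta>)"
  proof (rule berk_seminormI)
    fix f g assume "skew_product n \<phi> \<zeta> f \<noteq> top" "skew_product n \<phi> \<zeta> g \<noteq> top"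
    then have ne: "\<zeta> (\<phi> f) \<noteq> top" "\<zeta> (\<phi> g) \<noteq> top" by (simp_all add: skew_product_def top)
    obtain a where a: "0 \<le> a" "\<zeta> (\<phi> f) = ennreal a" using ne(1) by (cases "\<zeta> (\<phi> f)") auto
    obtain b where b: "0 \<le> b" "\<zeta> (\<phi> g) = ennreal b" using ne(2) by (cases "\<zeta> (\<phi> g)") auto
    have "\<zeta> (\<phi> (f + g)) \<le> ennreal (a + b)"
      using berk_add[OF r v, of "\<phi> f" "\<phi> g"] a b by (simp add: ring_hom_add[OF hom] ennreal_plus)
    then obtain d where d: "0 \<le> d" "\<zeta> (\<phi> (f + g)) = ennreal d" "d \<le> a + b"
      using a(1) b(1) by (cases "\<zeta> (\<phi> (f + g))") (auto simp: top_unique simp del: ennreal_plus)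
    have "root n d \<le> root n a + root n b"
      using d(3) root_add_le[OF n a(1) b(1)] n by (meson order_trans real_root_le_iff)
    then show "skew_product n \<phi> \<zeta> (f + g) \<le> skew_product n \<phi> \<zeta> f + skew_product n \<phi> \<zeta> g"
      using a b d n by (simp add: skew_product_def ennreal_root_ennreal ennreal_leI flip: ennreal_plus)
    have eq: "\<zeta> (\<phi> (f * g)) = ennreal (a * b)"
      using berk_mult[OF r v ne] a b by (simp add: ring_hom_mult[OF hom] ennreal_mult)
    show "skew_product n \<phi> \<zeta> (f * g) = skew_product n \<phi> \<zeta> f * skew_product n \<phi> \<zeta> g"
      unfolding skew_product_def a(2) b(2) eq ennreal_root_ennreal[OF a(1)]
        ennreal_root_ennreal[OF b(1)] ennreal_root_ennreal[OF mult_nonneg_nonneg[OF a(1) b(1)]]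
        real_root_mult
      by (rule ennreal_mult) (use a b n in simp_all)
  next
    fix c
    obtain g where "\<phi> (rconst c) = rconst g" "habs r g = habs r c ^ n"
      using skew_endo_habs[OF r \<phi>] by blast
    then show "skew_product n \<phi> \<zeta> (rconst c) = ennreal (habs r c)"
      using n by (simp add: skew_product_def berk_const[OF r v] ennreal_root_ennreal habs_nonneg
          real_root_power_cancel)
  next
    fix f :: "'k ratfun" assume "f \<noteq> 0"
    then have i: "\<zeta> (\<phi> (inverse f)) = inverse (\<zeta> (\<phi> f))"
      using berk_inverse[OF r v] ring_hom_nonzero[OF hom] by (simp add: ring_hom_inverse[OF hom])
    show "skew_product n \<phi> \<zeta> (inverse f) = inverse (skew_product n \<phi> \<zeta> f)"
    proof (cases "\<zeta> (\<phi> f)")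
      case (real a)
      show ?thesis
      proof (cases "a = 0")
        case True
        then show ?thesis using real i by (simp add: skew_product_def ennreal_root_def)
      next
        case False
        then have "a > 0" using real by simp
        then show ?thesis
          using real i n by (simp add: skew_product_def inverse_ennreal ennreal_root_ennreal real_root_inverse)
      qed
    next
      case top
      then show ?thesis using i by (simp add: skew_product_def ennreal_root_def)
    qed
  qed
  then show ?thesis using berk_line_iff[OF r] by blast
qed

lemma enat_lcm_dvd:
  assumes "a dvd enat N" "N > 0"
  shows "enat_lcm a b dvd enat_lcm b (enat N)"
proof -
  have "a \<noteq> \<infinity>"
  proof
    assume "a = \<infinity>"
    then obtain k where k: "enat N = \<infinity> * k" using assms(1) by (auto elim: dvdE)
    show False
    proof (cases "k = 0")
      case True
      then show False using k assms(2) by (simp add: zero_enat_def)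
    next
      case False
      then show False using k by (simp add: imult_infinity zero_less_iff_neq_zero)
    qed
  qed
  then obtain a' where a: "a = enat a'" by auto
  show ?thesis
  proof (cases b)
    case (enat m)
    then show ?thesis using assms by (simp add: a lcm.commute)
  qed (simp add: a)
qed

theorem theorem5p21:
  fixes r :: real
    and n :: nat
    and \<phi> :: "'k::{alg_closed_field, field_char_0} ratfun \<Rightarrow> 'k ratfun"
  assumes "0 < r" and "r < 1"
    and "puiseux_skew_endo r n \<phi>"
  shows "(\<forall>\<zeta>\<in>berk_line r. point_mult r (skew_product n \<phi> \<zeta>)
            dvd enat n * enat_lcm (point_mult r \<zeta>) (skew_mult r \<phi>)) \<and>
         (\<forall>N>0. skew_product n \<phi> ` points_dvd r (enat N)
            \<subseteq> points_dvd r (enat n * enat_lcm (skew_mult r \<phi>) (enat N)))"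
proof (intro conjI ballI allI impI subsetI)
  fix \<zeta> :: "'k ratfun \<Rightarrow> ennreal" assume "\<zeta> \<in> berk_line r"
  show "point_mult r (skew_product n \<phi> \<zeta>) dvd
      enat n * enat_lcm (point_mult r \<zeta>) (skew_mult r \<phi>)"
    by (rule point_mult_skew_product_dvd[OF assms])
next
  fix N :: nat and \<xi> assume N: "N > 0" and "\<xi> \<in> skew_product n \<phi> ` points_dvd r (enat N)"
  then obtain \<zeta> where \<zeta>: "\<zeta> \<in> berk_line r" "point_mult r \<zeta> dvd enat N" "\<xi> = skew_product n \<phi> \<zeta>"
    unfolding points_dvd_def by blast
  have "point_mult r \<xi> dvd enat n * enat_lcm (point_mult r \<zeta>) (skew_mult r \<phi>)"
    unfolding \<zeta>(3) by (rule point_mult_skew_product_dvd[OF assms])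
  also have "\<dots> dvd enat n * enat_lcm (skew_mult r \<phi>) (enat N)"
    by (intro mult_dvd_mono dvd_refl enat_lcm_dvd \<zeta>(2) N)
  finally show "\<xi> \<in> points_dvd r (enat n * enat_lcm (skew_mult r \<phi>) (enat N))"
    using skew_product_berk_line[OF assms \<zeta>(1)] \<zeta>(3) unfolding points_dvd_def by blast
qed

end
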